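(* Let $n\in\mathbb{N}$, let $E=E(\mathbb{R}^n)$ be a rearrangement-invariant space, and let $\Phi\in B_n(\infty)$. Then the cones $K_1$, $K_2$, $K_3$ (defined in the context) are equivalent: $$K_1\approx K_2\approx K_3 .$$
   Context: A rearrangement-invariant space (RIS) $E=E(\mathbb{R}^n)$ is a Banach function space (in the sense of Bennett–Sharpley) on $\mathbb{R}^n$ with Lebesgue measure whose norm satisfies $\|f\|_E\le\|g\|_E$ whenever $f^*\le g^*$. For measurable $f$, $f^*(t)=\inf\{y>0:\ |\{x:|f(x)|>y\}|\le t\}$ is the nonincreasing rearrangement and $f^{**}(t)=\frac1t\int_0^t f^*(\tau)\,d\tau$, $t>0$. Class $B_n(\infty)$: a function $\Phi:(0,\infty)\to(0,\infty)$ belongs to $B_n(\infty)$ if $\Phi$ is decreasing and continuous on $(0,\infty)$ and there is $C>0$ with $\int_0^r\Phi(\rho)\rho^{n-1}\,d\rho\le C\,\Phi(r)r^n$ for all $r\in(0,\infty)$. Generalized fractional maximal function: for $f\in E\cap L^1_{loc}(\mathbb{R}^n)$, $(M_\Phi f)(x)=\sup_{r>0}\Phi(r)\int_{B(x,r)}|f(y)|\,dy$, where $B(x,r)$ is the ball of center $x$, radius $r$. The space $M_E^\Phi=M_E^\Phi(\mathbb{R}^n)$ consists of all $u$ such that $u=M_\Phi f$ for some $f\in E$, with $\|u\|_{M_E^\Phi}=\inf\{\|f\|_E:\ f\in E,\ M_\Phi f=u\}$. Cones (sets of nonnegative measurable functions on $(0,\infty)$ with positive homogeneous functionals): $K_1=\{h:\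 h=u^*\text{ on }(0,\infty)\text{ for some }u\in M_E^\Phi\}$, $\rho_{K_1}(h)=\inf\{\|u\|_{M_E^\Phi}: u\in M_E^\Phi,\ u^*=h\}$; $K_2=\{h:\ h=u^{**}\text{ for some }u\in M_E^\Phi\}$, $\rho_{K_2}(h)=\inf\{\|u\|_{M_E^\Phi}: u\in M_E^\Phi,\ u^{**}=h\}$; $K_3=\{h:\ h(t)=\sup_{t<\tau<\infty}\tau\Phi(\tau^{1/n})u^{**}(\tau)\ \forall t>0,\text{ for some }u\in E\}$, $\rho_{K_3}(h)=\inf\{\|u\|_E: u\in E,\ \sup_{t<\tau<\infty}\tau\Phi(\tau^{1/n})u^{**}(\tau)=h(t)\ \forall t>0\}$. Covering: for two such cones $M,K$, we write $M\prec K$ ($K$ covers $M$) if there is $C_0>0$ such that for every $h_1\in M$ there exists $h_2\in K$ with $\rho_K(h_2)\le C_0\rho_M(h_1)$ and $h_1(t)\le h_2(t)$ for all $t\in(0,\infty)$. Equivalence $M\approx K$ means $M\prec K$ and $K\prec M$. *)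

theory Defs
  imports "HOL-Analysis.Analysis"
begin

text \<open>Functions on R^n are modelled on the type real^'n (n = CARD('n)), with Lebesgue
measure lebesgue. Following Bennett--Sharpley, a function norm acts on nonnegative
(extended-valued) Lebesgue measurable functions.\<close>

text \<open>Nonincreasing rearrangement f^*(t) = inf{y>0 : |{x : g x > y}| <= t} (for t > 0),
of a nonnegative (possibly infinite) function g; for a real f one uses g = |f|.\<close>
definition rearr :: "('a::euclidean_space \<Rightarrow> ennreal) \<Rightarrow> real \<Rightarrow> ennreal" where
  "rearr g t = Inf {y::ennreal. 0 < y \<and> emeasure lebesgue {x. y < g x} \<le> ennreal t}"

text \<open>f^{**}(t) = (1/t) * integral_0^t f^*(s) ds  (for t > 0).\<close>
definition rearr2 :: "('a::euclidean_space \<Rightarrow> ennreal) \<Rightarrow> real \<Rightarrow> ennreal" where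
  "rearr2 g t = set_nn_integral lborel {0<..<t} (rearr g) / ennreal t"

text \<open>Banach function norm (Bennett--Sharpley, axioms P1--P5).\<close>
definition banach_function_norm :: "(('a::euclidean_space \<Rightarrow> ennreal) \<Rightarrow> ennreal) \<Rightarrow> bool" where
  "banach_function_norm \<rho> \<longleftrightarrow>
     (\<forall>f \<in> borel_measurable lebesgue. \<rho> f = 0 \<longleftrightarrow> (AE x in lebesgue. f x = 0)) \<and>
     (\<forall>f \<in> borel_measurable lebesgue. \<forall>a::real. 0 \<le> a \<longrightarrow>
         \<rho> (\<lambda>x. ennreal a * f x) = ennreal a * \<rho> f) \<and>
     (\<forall>f \<in> borel_measurable lebesgue. \<forall>g \<in> borel_measurable lebesgue.
         \<rho> (\<lambda>x. f x + g x) \<le> \<rho> f + \<rho> g) \<and>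
     (\<forall>f \<in> borel_measurable lebesgue. \<forall>g \<in> borel_measurable lebesgue.
         (AE x in lebesgue. g x \<le> f x) \<longrightarrow> \<rho> g \<le> \<rho> f) \<and>
     (\<forall>fs f. (\<forall>k. fs k \<in> borel_measurable lebesgue) \<and> f \<in> borel_measurable lebesgue \<and>
         (AE x in lebesgue. incseq (\<lambda>k. fs k x) \<and> (SUP k. fs k x) = f x)
         \<longrightarrow> \<rho> f = (SUP k. \<rho> (fs k))) \<and>
     (\<forall>A \<in> sets lebesgue. emeasure lebesgue A < \<infinity> \<longrightarrow> \<rho> (indicator A) < \<infinity>) \<and>
     (\<forall>A \<in> sets lebesgue. emeasure lebesgue A < \<infinity> \<longrightarrow>
         (\<exists>C::real. \<forall>f \<in> borel_measurable lebesgue.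
            set_nn_integral lebesgue A f \<le> ennreal C * \<rho> f))"

text \<open>Rearrangement-invariant Banach function norm: rho f <= rho g whenever f^* <= g^*.\<close>
definition ri_norm :: "(('a::euclidean_space \<Rightarrow> ennreal) \<Rightarrow> ennreal) \<Rightarrow> bool" where
  "ri_norm \<rho> \<longleftrightarrow> banach_function_norm \<rho> \<and>
     (\<forall>f \<in> borel_measurable lebesgue. \<forall>g \<in> borel_measurable lebesgue.
        (\<forall>t>0. rearr f t \<le> rearr g t) \<longrightarrow> \<rho> f \<le> \<rho> g)"

text \<open>The space E and its norm ||f||_E = rho(|f|).\<close>
definition Espace :: "(('a::euclidean_space \<Rightarrow> ennreal) \<Rightarrow> ennreal) \<Rightarrow> ('a \<Rightarrow> real) set" where
  "Espace \<rho> = {f. f \<in> borel_measurable lebesgue \<and> \<rho> (\<lambda>x. ennreal \<bar>f x\<bar>) < \<infinity>}"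

definition Enorm :: "(('a::euclidean_space \<Rightarrow> ennreal) \<Rightarrow> ennreal) \<Rightarrow> ('a \<Rightarrow> real) \<Rightarrow> ennreal" where
  "Enorm \<rho> f = \<rho> (\<lambda>x. ennreal \<bar>f x\<bar>)"

definition locally_integrable :: "('a::euclidean_space \<Rightarrow> real) \<Rightarrow> bool" where
  "locally_integrable f \<longleftrightarrow> (\<forall>K. compact K \<longrightarrow> set_integrable lebesgue K f)"

text \<open>The class B_n(infinity).\<close>
definition class_B :: "nat \<Rightarrow> (real \<Rightarrow> real) \<Rightarrow> bool" where
  "class_B n \<Phi> \<longleftrightarrow>
     (\<forall>r>0. 0 < \<Phi> r) \<and>
     (\<forall>r s. 0 < r \<longrightarrow> r \<le> s \<longrightarrow> \<Phi> s \<le> \<Phi> r) \<and>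
     continuous_on {0<..} \<Phi> \<and>
     (\<exists>C>0. \<forall>r>0. set_nn_integral lborel {0<..<r} (\<lambda>s. ennreal (\<Phi> s * s ^ (n - 1)))
                    \<le> ennreal (C * \<Phi> r * r ^ n))"

text \<open>Generalized fractional maximal function.\<close>
definition maxfn :: "(real \<Rightarrow> real) \<Rightarrow> ('a::euclidean_space \<Rightarrow> real) \<Rightarrow> 'a \<Rightarrow> ennreal" where
  "maxfn \<Phi> f x = (SUP r\<in>{0<..}. ennreal (\<Phi> r) *
       set_nn_integral lebesgue (ball x r) (\<lambda>y. ennreal \<bar>f y\<bar>))"

definition MEspace :: "(('a::euclidean_space \<Rightarrow> ennreal) \<Rightarrow> ennreal) \<Rightarrow> (real \<Rightarrow> real) \<Rightarrow> ('a \<Rightarrow> ennreal) set" where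
  "MEspace \<rho> \<Phi> = {u. \<exists>f \<in> Espace \<rho>. locally_integrable f \<and> maxfn \<Phi> f = u}"

definition MEnorm :: "(('a::euclidean_space \<Rightarrow> ennreal) \<Rightarrow> ennreal) \<Rightarrow> (real \<Rightarrow> real) \<Rightarrow> ('a \<Rightarrow> ennreal) \<Rightarrow> ennreal" where
  "MEnorm \<rho> \<Phi> u = (INF f\<in>{f \<in> Espace \<rho>. locally_integrable f \<and> maxfn \<Phi> f = u}. Enorm \<rho> f)"

text \<open>Cones of functions on (0,infinity) (values outside (0,infinity) are irrelevant).\<close>
definition K1 :: "(('a::euclidean_space \<Rightarrow> ennreal) \<Rightarrow> ennreal) \<Rightarrow> (real \<Rightarrow> real) \<Rightarrow> (real \<Rightarrow> ennreal) set" where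
  "K1 \<rho> \<Phi> = {h. \<exists>u \<in> MEspace \<rho> \<Phi>. \<forall>t>0. h t = rearr u t}"

definition rhoK1 :: "(('a::euclidean_space \<Rightarrow> ennreal) \<Rightarrow> ennreal) \<Rightarrow> (real \<Rightarrow> real) \<Rightarrow> (real \<Rightarrow> ennreal) \<Rightarrow> ennreal" where
  "rhoK1 \<rho> \<Phi> h = (INF u\<in>{u \<in> MEspace \<rho> \<Phi>. \<forall>t>0. rearr u t = h t}. MEnorm \<rho> \<Phi> u)"

definition K2 :: "(('a::euclidean_space \<Rightarrow> ennreal) \<Rightarrow> ennreal) \<Rightarrow> (real \<Rightarrow> real) \<Rightarrow> (real \<Rightarrow> ennreal) set" where
  "K2 \<rho> \<Phi> = {h. \<exists>u \<in> MEspace \<rho> \<Phi>. \<forall>t>0. h t = rearr2 u t}"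

definition rhoK2 :: "(('a::euclidean_space \<Rightarrow> ennreal) \<Rightarrow> ennreal) \<Rightarrow> (real \<Rightarrow> real) \<Rightarrow> (real \<Rightarrow> ennreal) \<Rightarrow> ennreal" where
  "rhoK2 \<rho> \<Phi> h = (INF u\<in>{u \<in> MEspace \<rho> \<Phi>. \<forall>t>0. rearr2 u t = h t}. MEnorm \<rho> \<Phi> u)"

definition K3fun :: "nat \<Rightarrow> (real \<Rightarrow> real) \<Rightarrow> ('a::euclidean_space \<Rightarrow> real) \<Rightarrow> real \<Rightarrow> ennreal" where
  "K3fun n \<Phi> u t = (SUP \<tau>\<in>{t<..}. ennreal (\<tau> * \<Phi> (root n \<tau>)) * rearr2 (\<lambda>x. ennreal \<bar>u x\<bar>) \<tau>)"

definition K3 :: "nat \<Rightarrow> (('a::euclidean_space \<Rightarrow> ennreal) \<Rightarrow> ennreal) \<Rightarrow> (real \<Rightarrow> real) \<Rightarrow> (real \<Rightarrow> ennreal) set" where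
  "K3 n \<rho> \<Phi> = {h. \<exists>u \<in> Espace \<rho>. \<forall>t>0. h t = K3fun n \<Phi> u t}"

definition rhoK3 :: "nat \<Rightarrow> (('a::euclidean_space \<Rightarrow> ennreal) \<Rightarrow> ennreal) \<Rightarrow> (real \<Rightarrow> real) \<Rightarrow> (real \<Rightarrow> ennreal) \<Rightarrow> ennreal" where
  "rhoK3 n \<rho> \<Phi> h = (INF u\<in>{u \<in> Espace \<rho>. \<forall>t>0. K3fun n \<Phi> u t = h t}. Enorm \<rho> u)"

text \<open>Covering M \<prec> K, and equivalence of cones.\<close>
definition covered_by :: "(real \<Rightarrow> ennreal) set \<Rightarrow> ((real \<Rightarrow> ennreal) \<Rightarrow> ennreal)
    \<Rightarrow> (real \<Rightarrow> ennreal) set \<Rightarrow> ((real \<Rightarrow> ennreal) \<Rightarrow> ennreal) \<Rightarrow> bool" where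
  "covered_by M \<rho>M K \<rho>K \<longleftrightarrow> (\<exists>C0::real. C0 > 0 \<and>
     (\<forall>h1 \<in> M. \<exists>h2 \<in> K. \<rho>K h2 \<le> ennreal C0 * \<rho>M h1 \<and> (\<forall>t>0. h1 t \<le> h2 t)))"

definition cone_equiv :: "(real \<Rightarrow> ennreal) set \<Rightarrow> ((real \<Rightarrow> ennreal) \<Rightarrow> ennreal)
    \<Rightarrow> (real \<Rightarrow> ennreal) set \<Rightarrow> ((real \<Rightarrow> ennreal) \<Rightarrow> ennreal) \<Rightarrow> bool" where
  "cone_equiv M \<rho>M K \<rho>K \<longleftrightarrow> covered_by M \<rho>M K \<rho>K \<and> covered_by K \<rho>K M \<rho>M"

end

theory Submission
  imports Defs
begin

text \<open>
  Every element of \<open>E\<close> is locally integrable, so the three cones are the images of \<open>E\<close> under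
  \<open>T\<^sub>1 f = (M\<^sub>\<Phi> f)\<^sup>*\<close>, \<open>T\<^sub>2 f = (M\<^sub>\<Phi> f)\<^sup>*\<^sup>*\<close> and
  \<open>T\<^sub>3 f(t) = sup\<^bsub>\<tau> > t\<^esub> \<Phi>(\<tau>\<^sup>1\<^sup>/\<^sup>n) \<integral>\<^sub>0\<^sup>\<tau> f\<^sup>*\<close>, and the coverings form a cycle.
  Trivially \<open>T\<^sub>1 f \<le> T\<^sub>2 f\<close>. The class condition on \<open>\<Phi>\<close> bounds the integral of \<open>\<Phi>(|z|)\<close> over the ball of
  radius \<open>R\<close> by a multiple of \<open>\<Phi>(R) R\<^sup>n\<close>; splitting \<open>f\<close> at the level \<open>f\<^sup>*(t)\<close> and the radii at
  \<open>t\<^sup>1\<^sup>/\<^sup>n\<close> then gives \<open>T\<^sub>2 f \<le> C T\<^sub>3 f\<close>. Finally, for the radial decreasing rearrangement \<open>g\<close> of \<open>f\<close>,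
  the ball of radius \<open>2r\<close> around any point of \<open>B(0, r)\<close> contains \<open>B(0, r)\<close>, whence \<open>T\<^sub>3 f \<le> C T\<^sub>1 g\<close> by the
  doubling property of \<open>\<Phi>\<close>.
\<close>

subsection \<open>Nonincreasing rearrangement\<close>

lemma sets_lebesgue_superlevel:
  fixes g :: "'a::euclidean_space \<Rightarrow> ennreal"
  assumes "g \<in> borel_measurable lebesgue"
  shows "{x. y < g x} \<in> sets lebesgue"
  using borel_measurable_less[OF borel_measurable_const assms, of y] by simp

text \<open>The infimum in \<open>rearr\<close> is attained: the superlevel sets at levels
  decreasing to y exhaust the one at y, and measure is continuous from below. All later facts about
  rearrangements go through this equivalence.\<close>

lemma rearr_le_iff:
  assumes [measurable]: "g \<in> borel_measurable lebesgue"
  shows "rearr g t \<le> y \<longleftrightarrow> emeasure lebesgue {x. y < g x} \<le> ennreal t"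
proof
  assume "emeasure lebesgue {x. y < g x} \<le> ennreal t"
  \<comment> \<open>Levels strictly above y are positive, so the condition \<open>0 < y\<close> in
    \<open>rearr\<close> does no harm when y is 0.\<close>
  show "rearr g t \<le> y"
  proof (rule dense_ge)
    fix z assume z: "y < z"
    have "emeasure lebesgue {x. z < g x} \<le> emeasure lebesgue {x. y < g x}"
      using z by (intro emeasure_mono sets_lebesgue_superlevel assms) auto
    with z \<open>emeasure lebesgue {x. y < g x} \<le> ennreal t\<close> show "rearr g t \<le> z"
      unfolding rearr_def by (intro Inf_lower) (auto intro: order_trans simp: zero_less_iff_neq_zero)
  qed
next
  assume le: "rearr g t \<le> y"
  have above: "emeasure lebesgue {x. z < g x} \<le> ennreal t" if "y < z" for z
  proof -
    from le that have "rearr g t < z" by simp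
    then obtain y' where y': "y' < z" "emeasure lebesgue {x. y' < g x} \<le> ennreal t"
      unfolding rearr_def by (auto simp: Inf_less_iff)
    have "emeasure lebesgue {x. z < g x} \<le> emeasure lebesgue {x. y' < g x}"
      using y'(1) by (intro emeasure_mono sets_lebesgue_superlevel assms) auto
    with y'(2) show ?thesis by (rule order_trans[rotated])
  qed
  show "emeasure lebesgue {x. y < g x} \<le> ennreal t"
  \<comment> \<open>Only a finite y can be approached strictly from above; for infinite y the
    superlevel set is empty.\<close>
  proof (cases "y = top")
    case False
    define u where "u n = y + ennreal (1 / real (Suc n))" for n
    have yu: "y < u n" for n
      using False by (cases y) (auto simp: u_def ennreal_less_iff simp flip: ennreal_plus)
    have dec: "u m \<le> u n" if "n \<le> m" for m n
      using that by (auto simp: u_def intro!: add_left_mono ennreal_leI frac_le)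
    have "u \<longlonglongrightarrow> y + ennreal 0"
      unfolding u_def by (intro tendsto_intros tendsto_ennrealI LIMSEQ_Suc[OF lim_1_over_n])
    then have lim: "u \<longlonglongrightarrow> y" by simp
    have "{x. y < g x} = (\<Union>n. {x. u n < g x})"
    proof (intro set_eqI iffI)
      fix x assume "x \<in> {x. y < g x}"
      then have "eventually (\<lambda>n. u n < g x) sequentially"
        using order_tendstoD(2)[OF lim] by simp
      then show "x \<in> (\<Union>n. {x. u n < g x})"
        by (auto simp: eventually_sequentially)
    qed (use yu in \<open>auto intro: less_trans\<close>)
    also have "emeasure lebesgue \<dots> = (SUP n. emeasure lebesgue {x. u n < g x})"
      by (rule SUP_emeasure_incseq[symmetric]) (auto simp: incseq_def sets_lebesgue_superlevel intro: le_less_trans[OF dec])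
    also have "\<dots> \<le> ennreal t"
      by (intro SUP_least above yu)
    finally show ?thesis .
  qed simp
qed

lemma less_rearr_iff:
  assumes "g \<in> borel_measurable lebesgue"
  shows "y < rearr g t \<longleftrightarrow> ennreal t < emeasure lebesgue {x. y < g x}"
  using rearr_le_iff[OF assms, of t y] by (simp add: not_le[symmetric])

lemma rearr_mono_AE:
  assumes [measurable]: "f \<in> borel_measurable lebesgue" "g \<in> borel_measurable lebesgue"
    and "AE x in lebesgue. f x \<le> g x"
  shows "rearr f t \<le> rearr g t"
proof -
  have "emeasure lebesgue {x. rearr g t < f x} \<le> emeasure lebesgue {x. rearr g t < g x}"
  proof (rule emeasure_mono_AE)
    show "AE x in lebesgue. x \<in> {x. rearr g t < f x} \<longrightarrow> x \<in> {x. rearr g t < g x}"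
      using assms(3) by eventually_elim auto
  qed (simp add: sets_lebesgue_superlevel)
  also have "\<dots> \<le> ennreal t"
    using rearr_le_iff[of g t "rearr g t"] by simp
  finally show ?thesis by (simp add: rearr_le_iff)
qed

lemma rearr_antimono: "s \<le> t \<Longrightarrow> rearr g t \<le> rearr g s"
  unfolding rearr_def by (rule Inf_superset_mono) (auto intro: order_trans ennreal_leI)

lemma rearr_cmult:
  assumes [measurable]: "g \<in> borel_measurable lebesgue" and "0 \<le> a"
  shows "rearr (\<lambda>x. ennreal a * g x) t = ennreal a * rearr g t"
proof (cases "a = 0")
  case True
  have "rearr (\<lambda>x::'a. 0) t \<le> 0"
    by (subst rearr_le_iff) auto
  with True show ?thesis by simp
next
  case False
  with assms have a: "0 < a" by simp
  have *: "ennreal a * z \<le> y \<longleftrightarrow> z \<le> y / ennreal a" for z y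
    using a by (subst ennreal_mult_le_mult_iff[symmetric, of "ennreal a" z])
      (auto simp: ennreal_times_divide mult.commute[of "ennreal a" y] ennreal_mult_divide_eq)
  have "rearr (\<lambda>x. ennreal a * g x) t \<le> y \<longleftrightarrow> ennreal a * rearr g t \<le> y" for y
    using rearr_le_iff[of g t "y / ennreal a"]
    by (simp add: rearr_le_iff * not_le[symmetric])
  \<comment> \<open>Two elements with the same upper bounds coincide.\<close>
  then show ?thesis by (meson order_antisym order_refl)
qed

lemma rearr_add_const_le:
  assumes [measurable]: "v \<in> borel_measurable lebesgue"
  shows "rearr (\<lambda>x. a + v x) t \<le> a + rearr v t"
proof -
  have "emeasure lebesgue {x. a + rearr v t < a + v x} \<le> emeasure lebesgue {x. rearr v t < v x}"
    by (intro emeasure_mono sets_lebesgue_superlevel assms) (meson Collect_mono add_left_mono not_le)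
  also have "\<dots> \<le> ennreal t"
    using rearr_le_iff[of v t "rearr v t"] by simp
  finally have *: "emeasure lebesgue {x. a + rearr v t < a + v x} \<le> ennreal t" .
  have "(\<lambda>x. a + v x) \<in> borel_measurable lebesgue" by measurable
  from rearr_le_iff[OF this] * show ?thesis by blast
qed

text \<open>By \<open>less_rearr_iff\<close> a superlevel set consists of the t with
  \<open>ennreal t\<close> below a fixed value, and \<open>ennreal\<close> is measurable.\<close>

lemma borel_measurable_rearr:
  assumes "g \<in> borel_measurable lebesgue"
  shows "rearr g \<in> borel_measurable borel"
  by (rule borel_measurableI_greater) (simp add: less_rearr_iff[OF assms])

text \<open>Writing an extended value as a length lets the layer cake formula cover infinite values
  as well.\<close>

lemma emeasure_lborel_Ioo_ennreal:
  "emeasure lborel {y::real. 0 < y \<and> ennreal y < c} = c"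
proof (cases c)
  case (real r)
  then have "{y::real. 0 < y \<and> ennreal y < c} = {0<..<r}"
    by (auto simp: ennreal_less_iff)
  with real show ?thesis by simp
next
  case top
  have "ennreal r \<le> emeasure lborel {y::real. 0 < y \<and> ennreal y < c}" if "0 \<le> r" for r
  proof -
    have "emeasure lborel {0<..<r} \<le> emeasure lborel {y::real. 0 < y \<and> ennreal y < c}"
      using top by (intro emeasure_mono) auto
    with that show ?thesis by simp
  qed
  then have "z \<le> emeasure lborel {y::real. 0 < y \<and> ennreal y < c}" if "z < top" for z
    using that by (cases z) auto
  then have "top \<le> emeasure lborel {y::real. 0 < y \<and> ennreal y < c}"
    by (rule dense_le)
  with top show ?thesis by (simp add: top_unique)
qed

text \<open>Tonelli for the region under the graph of g over A, sliced vertically and then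
  horizontally.\<close>

lemma nn_integral_layer_cake:
  fixes g :: "'a::euclidean_space \<Rightarrow> ennreal"
  assumes [measurable]: "g \<in> borel_measurable borel" "A \<in> sets borel"
  shows "(\<integral>\<^sup>+x. g x * indicator A x \<partial>lborel)
       = (\<integral>\<^sup>+y. emeasure lborel (A \<inter> {x. ennreal y < g x}) * indicator {0<..} y \<partial>lborel)"
proof -
  have "(\<integral>\<^sup>+x. g x * indicator A x \<partial>lborel)
      = (\<integral>\<^sup>+x. (\<integral>\<^sup>+y. indicator {y::real. 0 < y \<and> ennreal y < g x} y * indicator A x \<partial>lborel) \<partial>lborel)"
    by (simp add: nn_integral_multc emeasure_lborel_Ioo_ennreal)
  also have "\<dots> = (\<integral>\<^sup>+x. (\<integral>\<^sup>+y. indicator {p. 0 < snd p \<and> ennreal (snd p) < g (fst p) \<and> fst p \<in> A} (x, y::real) \<partial>lborel) \<partial>lborel)"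
    by (intro nn_integral_cong) (auto simp: indicator_def)
  also have "\<dots> = (\<integral>\<^sup>+y. (\<integral>\<^sup>+x. indicator {p. 0 < snd p \<and> ennreal (snd p) < g (fst p) \<and> fst p \<in> A} (x, y::real) \<partial>lborel) \<partial>lborel)"
    by (rule lborel_pair.Fubini'[symmetric]) (simp add: case_prod_unfold)
  also have "\<dots> = (\<integral>\<^sup>+y. (\<integral>\<^sup>+x. indicator (A \<inter> {x. ennreal y < g x}) x * indicator {0<..} y \<partial>lborel) \<partial>lborel)"
    by (intro nn_integral_cong) (auto simp: indicator_def)
  also have "\<dots> = (\<integral>\<^sup>+y. emeasure lborel (A \<inter> {x. ennreal y < g x}) * indicator {0<..} y \<partial>lborel)"
    by (simp add: nn_integral_multc)
  finally show ?thesis .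
qed

text \<open>By \<open>less_rearr_iff\<close> the part of a superlevel set of \<open>rearr g\<close>
  inside (0, t) is an interval starting at 0, of length the smaller of t and the measure of the
  corresponding superlevel set of g. The layer cake formula then applies.\<close>

lemma set_nn_integral_rearr:
  fixes g :: "'a::euclidean_space \<Rightarrow> ennreal"
  assumes [measurable]: "g \<in> borel_measurable borel"
  shows "set_nn_integral lborel {0<..<t} (rearr g)
       = (\<integral>\<^sup>+y. min (ennreal t) (emeasure lborel {x. ennreal y < g x}) * indicator {0<..} y \<partial>lborel)"
proof -
  have g: "g \<in> borel_measurable lebesgue" by (simp add: measurable_completion)
  have [measurable]: "rearr g \<in> borel_measurable borel"
    by (rule borel_measurable_rearr[OF g])
  have "{0<..<t} \<inter> {s. ennreal y < rearr g s} = {s. 0 < s \<and> ennreal s < min (ennreal t) (emeasure lborel {x. ennreal y < g x})}" for y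
    by (auto simp: less_rearr_iff[OF g] ennreal_less_iff)
  then show ?thesis
    by (subst nn_integral_layer_cake) (simp_all add: emeasure_lborel_Ioo_ennreal del: min_less_iff_conj)
qed

text \<open>Hardy-Littlewood: at each level, the part of A where g exceeds that level has measure at
  most t and at most that of the whole superlevel set.\<close>

lemma set_nn_integral_le_rearr:
  fixes g :: "'a::euclidean_space \<Rightarrow> ennreal"
  assumes [measurable]: "g \<in> borel_measurable borel" "A \<in> sets borel"
    and "emeasure lborel A \<le> ennreal t"
  shows "set_nn_integral lborel A g \<le> set_nn_integral lborel {0<..<t} (rearr g)"
  unfolding set_nn_integral_rearr[OF assms(1)] nn_integral_layer_cake[OF assms(1,2)]
  by (intro nn_integral_mono mult_right_mono min.boundedI)
    (auto intro!: emeasure_mono order_trans[OF emeasure_mono assms(3)])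

lemma set_nn_integral_rearr_le:
  fixes g :: "'a::euclidean_space \<Rightarrow> ennreal"
  assumes [measurable]: "g \<in> borel_measurable borel"
  shows "set_nn_integral lborel {0<..<t} (rearr g) \<le> (\<integral>\<^sup>+x. g x \<partial>lborel)"
  using nn_integral_layer_cake[OF assms, of UNIV] unfolding set_nn_integral_rearr[OF assms(1)]
  by (auto intro!: nn_integral_mono mult_right_mono)

lemma rearr_le_rearr2:
  assumes "0 < t"
  shows "rearr g t \<le> rearr2 g t"
proof -
  have "rearr g t * ennreal t = (\<integral>\<^sup>+s. rearr g t * indicator {0<..<t} s \<partial>lborel)"
    using assms by (subst nn_integral_cmult_indicator) auto
  also have "\<dots> \<le> set_nn_integral lborel {0<..<t} (rearr g)"
    by (intro nn_integral_mono) (auto simp: indicator_def intro: rearr_antimono)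
  finally have "rearr g t * ennreal t / ennreal t \<le> rearr2 g t"
    unfolding rearr2_def by (rule divide_right_mono_ennreal)
  with assms show ?thesis by (simp add: ennreal_mult_divide_eq)
qed

lemma rearr2_cmult:
  assumes "g \<in> borel_measurable lebesgue" and "0 \<le> a"
  shows "rearr2 (\<lambda>x. ennreal a * g x) t = ennreal a * rearr2 g t"
  using borel_measurable_rearr[OF assms(1)]
  by (simp add: rearr2_def rearr_cmult[OF assms] mult.assoc nn_integral_cmult ennreal_times_divide)

lemma rearr2_mono_AE:
  assumes "f \<in> borel_measurable lebesgue" "g \<in> borel_measurable lebesgue"
    and "AE x in lebesgue. f x \<le> g x"
  shows "rearr2 f t \<le> rearr2 g t"
  unfolding rearr2_def
  by (intro divide_right_mono_ennreal nn_integral_mono mult_right_mono rearr_mono_AE assms) auto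

subsection \<open>Integrals of radial functions\<close>

text \<open>Reduces the two pushforward formulas below to volumes of balls.\<close>

lemma measure_eqI_atMost:
  fixes M N :: "real measure"
  assumes sets: "sets M = sets borel" "sets N = sets borel"
    and fin: "\<And>a. emeasure M {..a} < \<infinity>"
    and eq: "\<And>a. emeasure M {..a} = emeasure N {..a}"
  shows "M = N"
proof (rule measure_eqI_generator_eq[where E = "range atMost" and \<Omega> = UNIV and A = "\<lambda>i. {..real i}"])
  show "Int_stable (range atMost :: real set set)"
    by (auto simp: Int_stable_def Int_atMost)
  show "sets M = sigma_sets UNIV (range atMost)" "sets N = sigma_sets UNIV (range atMost)"
    using sets by (simp_all add: borel_eq_atMost)
  show "(\<Union>i. {..real i}) = UNIV"
    by (auto simp: real_arch_simple)
  show "emeasure M {..real i} \<noteq> \<infinity>" for i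
    using fin[of "real i"] by simp
qed (use eq in auto)

text \<open>Polar coordinates without a surface measure: on a half-line up to a, both sides give the
  volume of the closed ball of radius a, the right one by the fundamental theorem of
  calculus.\<close>

lemma distr_norm_lborel:
  "distr lborel borel (norm :: 'a::euclidean_space \<Rightarrow> real)
   = density lborel (\<lambda>r. ennreal (real DIM('a) * unit_ball_vol DIM('a) * r ^ (DIM('a) - 1)) * indicator {0<..} r)"
    (is "?L = ?R")
proof (rule measure_eqI_atMost)
  fix a :: real
  have preimage: "norm -` {..a} = (if 0 \<le> a then cball 0 a else {} :: 'a set)"
    by (auto intro: order_trans[OF norm_ge_zero])
  have L: "emeasure ?L {..a} = (if 0 \<le> a then ennreal (unit_ball_vol DIM('a) * a ^ DIM('a)) else 0)"
    by (subst emeasure_distr) (auto simp: preimage emeasure_cball)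
  then show "emeasure ?L {..a} < \<infinity>" by simp
  have "emeasure ?R {..a} = (\<integral>\<^sup>+r. ennreal (real DIM('a) * unit_ball_vol DIM('a) * r ^ (DIM('a) - 1))
      * indicator {0..a} r \<partial>lborel)"
  proof (subst emeasure_density)
    \<comment> \<open>Restoring the null point 0 gives a closed interval for the fundamental
      theorem.\<close>
    have "AE r in lborel. r \<noteq> (0::real)" by (rule AE_lborel_singleton)
    then show "(\<integral>\<^sup>+r. ennreal (real DIM('a) * unit_ball_vol DIM('a) * r ^ (DIM('a) - 1)) * indicator {0<..} r
        * indicator {..a} r \<partial>lborel)
      = (\<integral>\<^sup>+r. ennreal (real DIM('a) * unit_ball_vol DIM('a) * r ^ (DIM('a) - 1)) * indicator {0..a} r \<partial>lborel)"
      by (intro nn_integral_cong_AE, eventually_elim) (simp add: indicator_def)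
  qed auto
  also have "\<dots> = (if 0 \<le> a then ennreal (unit_ball_vol DIM('a) * a ^ DIM('a)) else 0)"
  proof (cases "0 \<le> a")
    case True
    have "(\<integral>\<^sup>+r. ennreal (real DIM('a) * unit_ball_vol DIM('a) * r ^ (DIM('a) - 1))
      * indicator {0..a} r \<partial>lborel) =
      ennreal (unit_ball_vol DIM('a) * a ^ DIM('a) - unit_ball_vol DIM('a) * 0 ^ DIM('a))"
    proof (rule nn_integral_FTC_Icc[where F = "\<lambda>r. unit_ball_vol DIM('a) * r ^ DIM('a)"])
      fix r :: real
      have "((\<lambda>r. unit_ball_vol DIM('a) * r ^ DIM('a)) has_real_derivative
          unit_ball_vol DIM('a) * (real DIM('a) * r ^ (DIM('a) - Suc 0))) (at r)"
        by (intro DERIV_cmult DERIV_pow)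
      then show "((\<lambda>r. unit_ball_vol DIM('a) * r ^ DIM('a)) has_real_derivative
          real DIM('a) * unit_ball_vol DIM('a) * r ^ (DIM('a) - 1)) (at r)"
        by (simp add: ac_simps)
    qed (use True in auto)
    with True show ?thesis by simp
  qed (auto simp: indicator_def)
  finally show "emeasure ?L {..a} = emeasure ?R {..a}"
    using L by simp
qed auto

text \<open>The map sends x to the volume of the centred ball with x on its boundary, so the
  preimage of a half-line up to a is a ball of volume a. This is the change of variables behind
  \<open>radial_rearr\<close>.\<close>

lemma distr_norm_power_lborel:
  "distr lborel borel (\<lambda>x::'a::euclidean_space. unit_ball_vol DIM('a) * norm x ^ DIM('a))
   = density lborel (indicator {0<..})"
    (is "?L = ?R")
proof (rule measure_eqI_atMost)
  fix a :: real
  let ?w = "unit_ball_vol (real DIM('a))"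
  have w: "0 < ?w" by simp
  have "(\<lambda>x::'a. ?w * norm x ^ DIM('a)) -` {..a} = (if 0 \<le> a then cball 0 (root DIM('a) (a / ?w)) else {})"
  proof -
    have "?w * norm x ^ DIM('a) \<le> a \<longleftrightarrow> norm x \<le> root DIM('a) (a / ?w)" if "0 \<le> a" for x :: 'a
    proof -
      have "norm x \<le> root DIM('a) (a / ?w) \<longleftrightarrow> norm x ^ DIM('a) \<le> root DIM('a) (a / ?w) ^ DIM('a)"
        using that w by (intro power_mono_iff[symmetric]) auto
      with that w show ?thesis by (simp add: field_simps)
    qed
    moreover have "\<not> ?w * norm x ^ DIM('a) \<le> a" if "\<not> 0 \<le> a" for x :: 'a
      using w that by (meson mult_nonneg_nonneg norm_ge_zero order_less_imp_le order_trans zero_le_power)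
    ultimately show ?thesis by auto
  qed
  then have L: "emeasure ?L {..a} = (if 0 \<le> a then ennreal a else 0)"
    by (subst emeasure_distr) (auto simp: emeasure_cball)
  then show "emeasure ?L {..a} < \<infinity>" by simp
  have "emeasure ?R {..a} = emeasure lborel {0<..a}"
    by (subst emeasure_density) (auto simp: indicator_inter_arith[symmetric] greaterThanAtMost_def)
  also have "\<dots> = (if 0 \<le> a then ennreal a else 0)"
    by auto
  finally show "emeasure ?L {..a} = emeasure ?R {..a}"
    using L by simp
qed auto

lemma nn_integral_norm:
  assumes [measurable]: "F \<in> borel_measurable borel"
  shows "(\<integral>\<^sup>+x. F (norm (x::'a::euclidean_space)) \<partial>lborel) =
    (\<integral>\<^sup>+r. ennreal (real DIM('a) * unit_ball_vol DIM('a) * r ^ (DIM('a) - 1)) * indicator {0<..} r * F r \<partial>lborel)"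
proof -
  have "(\<integral>\<^sup>+x. F (norm (x::'a)) \<partial>lborel) = (\<integral>\<^sup>+r. F r \<partial>distr lborel borel (norm :: 'a \<Rightarrow> real))"
    by (simp add: nn_integral_distr)
  then show ?thesis
    by (simp add: distr_norm_lborel nn_integral_density)
qed

lemma nn_integral_norm_power:
  assumes [measurable]: "F \<in> borel_measurable borel"
  shows "(\<integral>\<^sup>+x. F (unit_ball_vol DIM('a) * norm (x::'a::euclidean_space) ^ DIM('a)) \<partial>lborel) =
    set_nn_integral lborel {0<..} F"
proof -
  have "(\<integral>\<^sup>+x. F (unit_ball_vol DIM('a) * norm (x::'a) ^ DIM('a)) \<partial>lborel)
      = (\<integral>\<^sup>+r. F r \<partial>distr lborel borel (\<lambda>x::'a. unit_ball_vol DIM('a) * norm x ^ DIM('a)))"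
    by (simp add: nn_integral_distr)
  then show ?thesis
    by (simp add: distr_norm_power_lborel nn_integral_density mult.commute)
qed

subsection \<open>The class \<open>B\<^sub>n(\<infinity>)\<close>\<close>

lemma class_B_pos: "class_B n \<Phi> \<Longrightarrow> 0 < r \<Longrightarrow> 0 < \<Phi> r"
  and class_B_antimono: "class_B n \<Phi> \<Longrightarrow> 0 < r \<Longrightarrow> r \<le> s \<Longrightarrow> \<Phi> s \<le> \<Phi> r"
  by (auto simp: class_B_def)

text \<open>The class says nothing about \<Phi> off the positive half-line, hence the
  cut-off.\<close>

lemma class_B_measurable:
  assumes "class_B n \<Phi>"
  shows "(\<lambda>s. ennreal (\<Phi> s) * indicator {0<..<R} s) \<in> borel_measurable borel"
proof -
  have "continuous_on {0<..<R} \<Phi>"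
    using assms by (auto simp: class_B_def intro: continuous_on_subset)
  then have "(\<lambda>s. indicator {0<..<R} s *\<^sub>R \<Phi> s) \<in> borel_measurable borel"
    by (intro borel_measurable_continuous_on_indicator) auto
  then have "(\<lambda>s. ennreal (indicator {0<..<R} s *\<^sub>R \<Phi> s)) \<in> borel_measurable borel"
    by measurable
  moreover have "ennreal (indicator {0<..<R} s *\<^sub>R \<Phi> s) = ennreal (\<Phi> s) * indicator {0<..<R} s" for s
    by (simp add: indicator_def)
  ultimately show ?thesis by simp
qed

text \<open>The origin is cut out because \<open>\<Phi> 0\<close> is arbitrary; as a null point it
  does not affect integrals.\<close>

definition radial_kernel :: "(real \<Rightarrow> real) \<Rightarrow> real \<Rightarrow> 'a::euclidean_space \<Rightarrow> ennreal" where
  "radial_kernel \<Phi> R z = ennreal (\<Phi> (norm z)) * indicator {0<..<R} (norm z)"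

lemma radial_kernel_measurable:
  assumes "class_B n \<Phi>"
  shows "radial_kernel \<Phi> R \<in> borel_measurable borel"
  unfolding radial_kernel_def
  by (rule measurable_compose[OF borel_measurable_norm class_B_measurable[OF assms]])

text \<open>Polar coordinates turn the integral condition of the class into an L1 bound for the
  kernel.\<close>

lemma nn_integral_radial_kernel_le:
  assumes "class_B DIM('a::euclidean_space) \<Phi>"
  obtains D where "0 < D"
    "\<And>R. 0 < R \<Longrightarrow> (\<integral>\<^sup>+z. radial_kernel \<Phi> R (z::'a) \<partial>lborel) \<le> ennreal (D * \<Phi> R * R ^ DIM('a))"
proof -
  obtain C where C: "C > 0" "\<And>r. r > 0 \<Longrightarrow> set_nn_integral lborel {0<..<r} (\<lambda>s. ennreal (\<Phi> s * s ^ (DIM('a) - 1)))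
                    \<le> ennreal (C * \<Phi> r * r ^ DIM('a))"
    using assms unfolding class_B_def by blast
  \<comment> \<open>The area of the unit sphere.\<close>
  let ?k = "real DIM('a) * unit_ball_vol DIM('a)"
  have k: "0 < ?k" by simp
  show ?thesis
  proof
    show "0 < ?k * C" using k C(1) by simp
    fix R :: real assume "0 < R"
    note [measurable] = class_B_measurable[OF assms, of R]
    have "(\<integral>\<^sup>+z. radial_kernel \<Phi> R (z::'a) \<partial>lborel)
        = (\<integral>\<^sup>+r. ennreal (?k * r ^ (DIM('a) - 1)) * indicator {0<..} r * (ennreal (\<Phi> r) * indicator {0<..<R} r) \<partial>lborel)"
      unfolding radial_kernel_def by (subst nn_integral_norm) simp_all
    also have "\<dots> = (\<integral>\<^sup>+r. ennreal ?k * (ennreal (r ^ (DIM('a) - 1)) * (ennreal (\<Phi> r) * indicator {0<..<R} r)) \<partial>lborel)"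
      using k by (intro nn_integral_cong) (auto simp: indicator_def ennreal_mult' mult.assoc)
    also have "\<dots> = ennreal ?k * (\<integral>\<^sup>+r. ennreal (r ^ (DIM('a) - 1)) * (ennreal (\<Phi> r) * indicator {0<..<R} r) \<partial>lborel)"
      by (rule nn_integral_cmult) measurable
    also have "(\<integral>\<^sup>+r. ennreal (r ^ (DIM('a) - 1)) * (ennreal (\<Phi> r) * indicator {0<..<R} r) \<partial>lborel)
        = set_nn_integral lborel {0<..<R} (\<lambda>s. ennreal (\<Phi> s * s ^ (DIM('a) - 1)))"
      by (intro nn_integral_cong) (auto simp: indicator_def ennreal_mult'' mult.commute)
    also have "ennreal ?k * \<dots> \<le> ennreal ?k * ennreal (C * \<Phi> R * R ^ DIM('a))"
      by (intro mult_left_mono C \<open>0 < R\<close>) simp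
    also have "\<dots> = ennreal (?k * C * \<Phi> R * R ^ DIM('a))"
      using k by (simp add: ennreal_mult'[symmetric] mult.assoc)
    finally show "(\<integral>\<^sup>+z. radial_kernel \<Phi> R (z::'a) \<partial>lborel) \<le> ennreal (?k * C * \<Phi> R * R ^ DIM('a))" .
  qed
qed

text \<open>As \<Phi> decreases, the kernel is at least \<open>\<Phi> r\<close> on the punctured
  ball of radius r.\<close>

lemma nn_integral_radial_kernel_ge:
  assumes "class_B DIM('a::euclidean_space) \<Phi>" "0 < r" "r \<le> R"
  shows "ennreal (\<Phi> r * (unit_ball_vol DIM('a) * r ^ DIM('a))) \<le> (\<integral>\<^sup>+z. radial_kernel \<Phi> R (z::'a) \<partial>lborel)"
proof -
  have "ennreal (\<Phi> r * (unit_ball_vol DIM('a) * r ^ DIM('a))) = ennreal (\<Phi> r) * emeasure lborel (ball (0::'a) r)"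
    using class_B_pos[OF assms(1,2)] assms(2) by (simp add: emeasure_ball ennreal_mult')
  also have "\<dots> = (\<integral>\<^sup>+z. ennreal (\<Phi> r) * indicator (ball (0::'a) r) z \<partial>lborel)"
    by (rule nn_integral_cmult_indicator[symmetric]) simp
  also have "\<dots> \<le> (\<integral>\<^sup>+z. radial_kernel \<Phi> R (z::'a) \<partial>lborel)"
  proof (rule nn_integral_mono_AE)
    have "AE z in lborel. z \<noteq> (0::'a)" by (rule AE_lborel_singleton)
    then show "AE z in lborel. ennreal (\<Phi> r) * indicator (ball (0::'a) r) z \<le> radial_kernel \<Phi> R z"
    proof eventually_elim
      case (elim z)
      with assms(3) class_B_antimono[OF assms(1), of "norm z" r] show ?case
        by (auto simp: radial_kernel_def indicator_def intro!: ennreal_leI)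
    qed
  qed
  finally show ?thesis .
qed

text \<open>The integral of the kernel of radius \<open>l * r\<close> is bounded below through the
  ball of radius r and above by the class condition; the power of r cancels.\<close>

lemma class_B_doubling:
  assumes "class_B DIM('a::euclidean_space) \<Phi>" "1 \<le> l"
  obtains c where "0 < c" "\<And>r. 0 < r \<Longrightarrow> \<Phi> r \<le> c * \<Phi> (l * r)"
proof -
  obtain D where D: "0 < D"
    "\<And>R. 0 < R \<Longrightarrow> (\<integral>\<^sup>+z. radial_kernel \<Phi> R (z::'a) \<partial>lborel) \<le> ennreal (D * \<Phi> R * R ^ DIM('a))"
    using nn_integral_radial_kernel_le[OF assms(1)] by blast
  let ?w = "unit_ball_vol (real DIM('a))"
  have w: "0 < ?w" by simp
  show ?thesis
  proof
    show "0 < D * l ^ DIM('a) / ?w" using D(1) w assms(2) by simp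
    fix r :: real assume r: "0 < r"
    with assms(2) have lr: "0 < l * r" "r \<le> l * r" by auto
    have "ennreal (\<Phi> r * (?w * r ^ DIM('a))) \<le> ennreal (D * \<Phi> (l * r) * (l * r) ^ DIM('a))"
      using nn_integral_radial_kernel_ge[OF assms(1) r lr(2)] D(2)[OF lr(1)] by (rule order_trans)
    moreover have "0 \<le> D * \<Phi> (l * r) * (l * r) ^ DIM('a)"
      using D(1) class_B_pos[OF assms(1) lr(1)] lr(1) by simp
    ultimately have "\<Phi> r * (?w * r ^ DIM('a)) \<le> D * \<Phi> (l * r) * (l * r) ^ DIM('a)"
      by simp
    then have "\<Phi> r * ?w \<le> D * l ^ DIM('a) * \<Phi> (l * r)"
      using r by (simp add: power_mult_distrib field_simps)
    then show "\<Phi> r \<le> D * l ^ DIM('a) / ?w * \<Phi> (l * r)"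
      using w by (simp add: field_simps)
  qed
qed

subsection \<open>The maximal function\<close>

lemma maxfn_cong_AE:
  assumes "AE x in lebesgue. f x = g x"
  shows "maxfn \<Phi> f = maxfn \<Phi> g"
  unfolding maxfn_def using assms
  by (intro ext SUP_cong arg_cong2[where f = "(*)"] refl nn_integral_cong_AE) auto

lemma maxfn_mono_AE:
  assumes "AE x in lebesgue. \<bar>f x\<bar> \<le> \<bar>g x\<bar>"
  shows "maxfn \<Phi> f x \<le> maxfn \<Phi> g x"
  unfolding maxfn_def using assms
  by (intro SUP_mono' mult_left_mono nn_integral_mono_AE) (auto intro!: mult_right_mono ennreal_leI)

lemma maxfn_cmult:
  assumes "f \<in> borel_measurable lebesgue" "0 \<le> a"
  shows "maxfn \<Phi> (\<lambda>x. a * f x) x = ennreal a * maxfn \<Phi> f x"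
proof -
  have "set_nn_integral lebesgue (ball x r) (\<lambda>y. ennreal \<bar>a * f y\<bar>)
      = ennreal a * set_nn_integral lebesgue (ball x r) (\<lambda>y. ennreal \<bar>f y\<bar>)" for r
  proof -
    have [measurable]: "ball x r \<in> sets lebesgue" by simp
    show ?thesis
      using assms by (subst nn_integral_cmult[symmetric]) (auto simp: abs_mult ennreal_mult' mult.assoc)
  qed
  then show ?thesis
    unfolding maxfn_def SUP_mult_left_ennreal by (simp add: ac_simps)
qed

text \<open>Lower semicontinuity: by continuity from below a slightly smaller concentric ball
  already pushes the value above y, and that ball stays inside the ball of radius r around every
  nearby centre.\<close>

lemma open_superlevel_maxfn:
  assumes [measurable]: "f \<in> borel_measurable lebesgue"
  shows "open {x. y < maxfn \<Phi> f x}"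
proof (rule openI)
  fix x assume "x \<in> {x. y < maxfn \<Phi> f x}"
  then obtain r where r: "0 < r"
    and y: "y < ennreal (\<Phi> r) * set_nn_integral lebesgue (ball x r) (\<lambda>y. ennreal \<bar>f y\<bar>)"
    by (auto simp: maxfn_def less_SUP_iff)
  \<comment> \<open>For small n the radius may be negative and the ball empty. The gap
    \<open>1 / real (Suc n)\<close> later serves as the radius of the neighbourhood.\<close>
  let ?B = "\<lambda>n::nat. ball x (r - 1 / real (Suc n))"
  have *: "set_nn_integral lebesgue A (\<lambda>y. ennreal \<bar>f y\<bar>) = emeasure (density lebesgue (\<lambda>y. ennreal \<bar>f y\<bar>)) A"
    if "A \<in> sets lebesgue" for A
    using that by (simp add: emeasure_density)
  have ball: "ball x r = (\<Union>n. ?B n)"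
  proof (intro set_eqI iffI)
    fix z assume "z \<in> ball x r"
    then obtain n where "1 / real (Suc n) < r - dist x z"
      using reals_Archimedean[of "r - dist x z"] by (auto simp: inverse_eq_divide)
    then show "z \<in> (\<Union>n. ?B n)" by (auto simp: algebra_simps intro!: exI[of _ n])
  qed (auto intro: less_le_trans)
  have "incseq ?B"
    by (auto simp: incseq_def intro!: frac_le subset_ball)
  then have "set_nn_integral lebesgue (ball x r) (\<lambda>y. ennreal \<bar>f y\<bar>)
      = (SUP n. set_nn_integral lebesgue (?B n) (\<lambda>y. ennreal \<bar>f y\<bar>))"
    by (simp add: * ball SUP_emeasure_incseq image_subset_iff)
  with y obtain n where n: "y < ennreal (\<Phi> r) * set_nn_integral lebesgue (?B n) (\<lambda>y. ennreal \<bar>f y\<bar>)"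
    by (auto simp: SUP_mult_left_ennreal less_SUP_iff)
  show "\<exists>e>0. ball x e \<subseteq> {x. y < maxfn \<Phi> f x}"
  proof (intro exI conjI subsetI)
    show "0 < 1 / real (Suc n)" by simp
    fix x' assume x': "x' \<in> ball x (1 / real (Suc n))"
    have "?B n \<subseteq> ball x' r"
    proof
      fix z assume "z \<in> ?B n"
      with x' dist_triangle[of x' z x] show "z \<in> ball x' r"
        by (simp add: dist_commute)
    qed
    then have "set_nn_integral lebesgue (?B n) (\<lambda>y. ennreal \<bar>f y\<bar>) \<le> set_nn_integral lebesgue (ball x' r) (\<lambda>y. ennreal \<bar>f y\<bar>)"
      by (intro nn_integral_mono) (auto simp: indicator_def)
    then have "ennreal (\<Phi> r) * set_nn_integral lebesgue (?B n) (\<lambda>y. ennreal \<bar>f y\<bar>) \<le> maxfn \<Phi> f x'"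
      unfolding maxfn_def using r by (intro SUP_upper2[of r] mult_left_mono) auto
    with n show "x' \<in> {x. y < maxfn \<Phi> f x}" by auto
  qed
qed

lemma borel_measurable_maxfn:
  assumes "f \<in> borel_measurable lebesgue"
  shows "maxfn \<Phi> f \<in> borel_measurable borel"
  using open_superlevel_maxfn[OF assms] by (intro borel_measurableI_greater) auto

section \<open>Upper bound for the averaged rearrangement of the maximal function\<close>

lemma K3fun_eq:
  assumes "0 < t"
  shows "K3fun n \<Phi> f t = (SUP \<tau>\<in>{t<..}. ennreal (\<Phi> (root n \<tau>)) *
    set_nn_integral lborel {0<..<\<tau>} (rearr (\<lambda>x. ennreal \<bar>f x\<bar>)))"
  unfolding K3fun_def rearr2_def
proof (intro SUP_cong refl)
  fix \<tau> assume "\<tau> \<in> {t<..}"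
  with assms have "0 < \<tau>" by simp
  then have cancel: "ennreal \<tau> * (I / ennreal \<tau>) = I" for I
    by (simp add: ennreal_times_divide mult.commute[of "ennreal \<tau>"] ennreal_mult_divide_eq)
  have "ennreal (\<tau> * p) * (I / ennreal \<tau>) = ennreal p * (ennreal \<tau> * (I / ennreal \<tau>))" for p I
    using \<open>0 < \<tau>\<close> by (simp add: ennreal_mult' ac_simps)
  then show "ennreal (\<tau> * \<Phi> (root n \<tau>)) * (set_nn_integral lborel {0<..<\<tau>} (rearr (\<lambda>x. ennreal \<bar>f x\<bar>)) / ennreal \<tau>)
    = ennreal (\<Phi> (root n \<tau>)) * set_nn_integral lborel {0<..<\<tau>} (rearr (\<lambda>x. ennreal \<bar>f x\<bar>))"
    by (simp only: cancel)
qed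

lemma nn_integral_lborel_diff:
  fixes k :: "'a::euclidean_space \<Rightarrow> ennreal"
  assumes [measurable]: "k \<in> borel_measurable borel"
  shows "(\<integral>\<^sup>+x. k (x - y) \<partial>lborel) = (\<integral>\<^sup>+x. k x \<partial>lborel)"
proof -
  have "(\<integral>\<^sup>+x. k x \<partial>lborel) = (\<integral>\<^sup>+x. k x \<partial>distr lborel borel ((+) (- y)))"
    by (simp add: lborel_distr_plus)
  also have "\<dots> = (\<integral>\<^sup>+x. k (- y + x) \<partial>lborel)"
    by (simp add: nn_integral_distr)
  finally show ?thesis by simp
qed

text \<open>Tonelli and translation invariance. Below it combines the L1 bounds of the kernel and of
  the high part of f.\<close>

lemma nn_integral_convolution:
  fixes k g :: "'a::euclidean_space \<Rightarrow> ennreal"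
  assumes [measurable]: "k \<in> borel_measurable borel" "g \<in> borel_measurable borel"
  shows "(\<integral>\<^sup>+x. (\<integral>\<^sup>+y. k (x - y) * g y \<partial>lborel) \<partial>lborel) = (\<integral>\<^sup>+x. k x \<partial>lborel) * (\<integral>\<^sup>+y. g y \<partial>lborel)"
proof -
  have "(\<integral>\<^sup>+x. (\<integral>\<^sup>+y. k (x - y) * g y \<partial>lborel) \<partial>lborel) = (\<integral>\<^sup>+y. (\<integral>\<^sup>+x. k (x - y) * g y \<partial>lborel) \<partial>lborel)"
    by (rule lborel_pair.Fubini'[symmetric]) (simp add: case_prod_unfold)
  also have "\<dots> = (\<integral>\<^sup>+y. (\<integral>\<^sup>+x. k x \<partial>lborel) * g y \<partial>lborel)"
    by (simp add: nn_integral_multc nn_integral_lborel_diff)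
  finally show ?thesis by (simp add: nn_integral_cmult)
qed

text \<open>Inside the ball \<open>\<Phi> r\<close> is at most \<Phi> of the distance to x, as
  \<Phi> decreases. The bound does not depend on r, so a single convolution controls all radii up to
  R.\<close>

lemma set_nn_integral_ball_le_radial_kernel:
  assumes "class_B n \<Phi>" "0 < r" "r \<le> R" and [measurable]: "g \<in> borel_measurable borel"
  shows "ennreal (\<Phi> r) * set_nn_integral lborel (ball x r) g \<le> (\<integral>\<^sup>+y. radial_kernel \<Phi> R (x - y) * g y \<partial>lborel)"
proof -
  have [measurable]: "ball x r \<in> sets borel" by simp
  have "ennreal (\<Phi> r) * set_nn_integral lborel (ball x r) g
      = (\<integral>\<^sup>+y. ennreal (\<Phi> r) * (g y * indicator (ball x r) y) \<partial>lborel)"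
    by (rule nn_integral_cmult[symmetric]) simp
  also have "\<dots> \<le> (\<integral>\<^sup>+y. radial_kernel \<Phi> R (x - y) * g y \<partial>lborel)"
  proof (rule nn_integral_mono_AE)
    have "AE y in lborel. y \<noteq> x" by (rule AE_lborel_singleton)
    then show "AE y in lborel. ennreal (\<Phi> r) * (g y * indicator (ball x r) y) \<le> radial_kernel \<Phi> R (x - y) * g y"
    proof eventually_elim
      case (elim y)
      with assms(3) class_B_antimono[OF assms(1), of "norm (x - y)" r] show ?case
        by (auto simp: radial_kernel_def indicator_def dist_norm intro!: mult_right_mono ennreal_leI)
    qed
  qed
  finally show ?thesis .
qed

text \<open>At scale \<open>R = root n t\<close> the part of \<open>f\<close> above the level \<open>f\<^sup>*(t)\<close> has support of measure at most \<open>t\<close> and is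
  treated in \<open>L\<^sup>1\<close> through a truncated radial kernel, whereas the remaining part and all radii
  \<open>r \<ge> R\<close> contribute a bounded function. No weak type estimate is needed.\<close>
lemma rearr2_maxfn_le_K3fun_borel:
  assumes "class_B DIM('a::euclidean_space) \<Phi>"
  obtains C where "0 < C"
    "\<And>(f::'a \<Rightarrow> real) t. f \<in> borel_measurable borel \<Longrightarrow> 0 < t \<Longrightarrow>
      rearr2 (maxfn \<Phi> f) t \<le> ennreal C * K3fun DIM('a) \<Phi> f t"
proof -
  let ?n = "DIM('a)"
  let ?w = "unit_ball_vol (real ?n)"
  obtain D where D: "0 < D"
    "\<And>R. 0 < R \<Longrightarrow> (\<integral>\<^sup>+z. radial_kernel \<Phi> R (z::'a) \<partial>lborel) \<le> ennreal (D * \<Phi> R * R ^ ?n)"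
    using nn_integral_radial_kernel_le[OF assms] by blast
  \<comment> \<open>\<open>m * r ^ ?n\<close> bounds the volume of a ball of radius r. The factor 2
    makes m exceed 1, so that this number lies strictly above t for all r from R on, as the supremum
    in \<open>K3fun\<close> requires.\<close>
  define m where "m = 2 * max 1 ?w"
  have m: "1 < m" "?w \<le> m" by (auto simp: m_def)
  have l: "1 \<le> root ?n m" using m by simp
  obtain c where c: "0 < c" "\<And>r. 0 < r \<Longrightarrow> \<Phi> r \<le> c * \<Phi> (root ?n m * r)"
    using class_B_doubling[OF assms l] by blast
  show ?thesis
  proof
    show "0 < 2 * D * c + c" using D(1) c(1) by (simp add: add_pos_pos)
    fix f :: "'a \<Rightarrow> real" and t :: real
    assume [measurable]: "f \<in> borel_measurable borel" and t: "0 < t"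
    define g where "g = (\<lambda>x. ennreal \<bar>f x\<bar>)"
    have [measurable]: "g \<in> borel_measurable borel" unfolding g_def by measurable
    have g_leb: "g \<in> borel_measurable lebesgue" by (simp add: measurable_completion)
    have f_leb: "f \<in> borel_measurable lebesgue" by (simp add: measurable_completion)
    define I where "I s = set_nn_integral lborel {0<..<s} (rearr g)" for s
    define S where "S = K3fun ?n \<Phi> f t"
    define R where "R = root ?n t"
    have R: "0 < R" "R ^ ?n = t" using t by (simp_all add: R_def)
    have I_mono: "I s \<le> I s'" if "s \<le> s'" for s s'
      unfolding I_def using that by (intro nn_integral_mono mult_left_mono) (auto simp: indicator_def)
    \<comment> \<open>The single term of the supremum at \<open>m * r ^ ?n\<close> suffices;
      doubling pays for replacing r by the root of that number.\<close>
    have large: "ennreal (\<Phi> r) * I s \<le> ennreal c * S" if r: "R \<le> r" and s: "s \<le> m * r ^ ?n" for r s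
    proof -
      have r0: "0 < r" using R r by linarith
      have rt: "t \<le> r ^ ?n" using power_mono[OF r, of ?n] R by simp
      have "r ^ ?n < m * r ^ ?n" using m r0 by simp
      with rt have tau: "t < m * r ^ ?n" by simp
      have root: "root ?n (m * r ^ ?n) = root ?n m * r"
        using r0 by (simp add: real_root_mult real_root_power_cancel)
      have "ennreal (\<Phi> r) * I s \<le> ennreal (c * \<Phi> (root ?n m * r)) * I (m * r ^ ?n)"
        by (intro mult_mono ennreal_leI c r0 I_mono s) auto
      also have "\<dots> = ennreal c * (ennreal (\<Phi> (root ?n (m * r ^ ?n))) * I (m * r ^ ?n))"
        using c by (simp add: root ennreal_mult' mult.assoc)
      also have "\<dots> \<le> ennreal c * S"
        unfolding S_def K3fun_eq[OF t] g_def[symmetric] I_def[symmetric]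
        using tau by (intro mult_left_mono SUP_upper) auto
      finally show ?thesis .
    qed
    have base: "ennreal (\<Phi> R) * I t \<le> ennreal c * S"
      using m R t by (intro large) auto
    define lv where "lv = rearr g t"
    define A where "A = {x. lv < g x}"
    have [measurable]: "A \<in> sets borel" unfolding A_def by measurable
    have A: "emeasure lborel A \<le> ennreal t"
      using rearr_le_iff[OF g_leb, of t lv] by (simp add: A_def lv_def)
    define g1 where "g1 x = g x * indicator A x" for x
    have [measurable]: "g1 \<in> borel_measurable borel" unfolding g1_def by measurable
    have g1: "(\<integral>\<^sup>+x. g1 x \<partial>lborel) \<le> I t"
      unfolding g1_def I_def by (rule set_nn_integral_le_rearr[OF _ _ A]) measurable
    have g_le: "g x \<le> g1 x + lv" for x
      by (auto simp: g1_def A_def indicator_def)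
    note [measurable] = radial_kernel_measurable[OF assms, of R]
    define v where "v x = (\<integral>\<^sup>+y. radial_kernel \<Phi> R (x - y) * g1 y \<partial>lborel)" for x :: 'a
    have [measurable]: "v \<in> borel_measurable borel" unfolding v_def by measurable
    have v: "(\<integral>\<^sup>+x. v x \<partial>lborel) \<le> ennreal t * (ennreal D * (ennreal c * S))"
    proof -
      have "(\<integral>\<^sup>+x. v x \<partial>lborel) = (\<integral>\<^sup>+z. radial_kernel \<Phi> R (z::'a) \<partial>lborel) * (\<integral>\<^sup>+x. g1 x \<partial>lborel)"
        unfolding v_def by (rule nn_integral_convolution) measurable
      also have "\<dots> \<le> ennreal (D * \<Phi> R * R ^ ?n) * I t"
        by (intro mult_mono D R g1) auto
      also have "\<dots> = ennreal t * (ennreal D * (ennreal (\<Phi> R) * I t))"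
        using D class_B_pos[OF assms R(1)] t by (simp add: R ennreal_mult ac_simps)
      also have "\<dots> \<le> ennreal t * (ennreal D * (ennreal c * S))"
        by (intro mult_left_mono base) auto
      finally show ?thesis .
    qed
    \<comment> \<open>\<open>lv\<close> is the value at t of a nonincreasing function, hence at most
      its mean over (0, t).\<close>
    have tlv: "ennreal t * lv \<le> I t"
    proof -
      have "ennreal t * lv \<le> ennreal t * (I t / ennreal t)"
        using rearr_le_rearr2[OF t, of g] by (intro mult_left_mono) (auto simp: rearr2_def I_def lv_def)
      then show ?thesis
        using t by (simp add: ennreal_times_divide mult.commute[of "ennreal t"] ennreal_mult_divide_eq)
    qed
    \<comment> \<open>The first summand pays for the low part at radii below R, the second for all
      radii from R on.\<close>
    define a where "a = ennreal D * (ennreal c * S) + ennreal c * S"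
    have M_le: "maxfn \<Phi> f x \<le> a + v x" for x
      unfolding maxfn_def
    proof (rule SUP_least)
      fix r :: real assume "r \<in> {0<..}"
      then have r: "0 < r" by simp
      have [measurable]: "ball x r \<in> sets borel" by simp
      have int: "set_nn_integral lebesgue (ball x r) (\<lambda>y. ennreal \<bar>f y\<bar>) = set_nn_integral lborel (ball x r) g"
        by (simp add: nn_integral_completion g_def)
      show "ennreal (\<Phi> r) * set_nn_integral lebesgue (ball x r) (\<lambda>y. ennreal \<bar>f y\<bar>) \<le> a + v x"
      proof (cases "R \<le> r")
        case True
        have "set_nn_integral lborel (ball x r) g \<le> I (?w * r ^ ?n)"
          unfolding I_def using r by (intro set_nn_integral_le_rearr) (auto simp: emeasure_ball)
        then have "ennreal (\<Phi> r) * set_nn_integral lborel (ball x r) g \<le> ennreal (\<Phi> r) * I (?w * r ^ ?n)"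
          by (rule mult_left_mono) simp
        also have "\<dots> \<le> ennreal c * S"
          using True m r by (intro large mult_right_mono) auto
        finally show ?thesis
          unfolding int a_def by (auto intro: order_trans add_increasing add_increasing2)
      next
        case False
        then have rR: "r \<le> R" by simp
        have "set_nn_integral lborel (ball x r) g \<le> (\<integral>\<^sup>+y. g1 y * indicator (ball x r) y + lv * indicator (ball x r) y \<partial>lborel)"
          using g_le by (intro nn_integral_mono) (auto simp: indicator_def)
        also have "\<dots> = set_nn_integral lborel (ball x r) g1 + lv * ennreal (?w * r ^ ?n)"
          using r by (simp add: nn_integral_add nn_integral_cmult_indicator emeasure_ball)
        finally have "ennreal (\<Phi> r) * set_nn_integral lborel (ball x r) g
            \<le> ennreal (\<Phi> r) * (set_nn_integral lborel (ball x r) g1 + lv * ennreal (?w * r ^ ?n))"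
          by (rule mult_left_mono) simp
        also have "\<dots> = ennreal (\<Phi> r) * set_nn_integral lborel (ball x r) g1 + ennreal (\<Phi> r * (?w * r ^ ?n)) * lv"
          using class_B_pos[OF assms r] r by (simp add: distrib_left ennreal_mult ac_simps)
        also have "\<dots> \<le> v x + ennreal D * (ennreal c * S)"
        proof (rule add_mono)
          show "ennreal (\<Phi> r) * set_nn_integral lborel (ball x r) g1 \<le> v x"
            unfolding v_def by (rule set_nn_integral_ball_le_radial_kernel[OF assms r rR]) measurable
          \<comment> \<open>Lower and upper bound of the kernel integral are chained, so the radius
            r disappears from the estimate.\<close>
          have "ennreal (\<Phi> r * (?w * r ^ ?n)) * lv \<le> ennreal (D * \<Phi> R * R ^ ?n) * lv"
            using nn_integral_radial_kernel_ge[OF assms r rR] D(2)[OF R(1)]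
            by (intro mult_right_mono) (auto intro: order_trans)
          also have "\<dots> = ennreal D * (ennreal (\<Phi> R) * (ennreal t * lv))"
            using D class_B_pos[OF assms R(1)] t by (simp add: R ennreal_mult ac_simps)
          also have "\<dots> \<le> ennreal D * (ennreal (\<Phi> R) * I t)"
            by (intro mult_left_mono tlv) auto
          also have "\<dots> \<le> ennreal D * (ennreal c * S)"
            by (intro mult_left_mono base) auto
          finally show "ennreal (\<Phi> r * (?w * r ^ ?n)) * lv \<le> ennreal D * (ennreal c * S)" .
        qed
        also have "\<dots> \<le> a + v x"
          unfolding a_def by (simp add: ac_simps add_left_mono)
        finally show ?thesis unfolding int .
      qed
    qed
    have v_leb: "v \<in> borel_measurable lebesgue" by (simp add: measurable_completion)
    note [measurable] = borel_measurable_rearr[OF v_leb]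
    have M_leb: "maxfn \<Phi> f \<in> borel_measurable lebesgue"
      using borel_measurable_maxfn[OF f_leb, of \<Phi>] by (simp add: measurable_completion)
    have av_leb: "(\<lambda>x. a + v x) \<in> borel_measurable lebesgue"
      by (rule borel_measurable_add[OF borel_measurable_const v_leb])
    have "set_nn_integral lborel {0<..<t} (rearr (maxfn \<Phi> f))
        \<le> (\<integral>\<^sup>+s. a * indicator {0<..<t} s + rearr v s * indicator {0<..<t} s \<partial>lborel)"
    proof (rule nn_integral_mono)
      fix s
      have "rearr (maxfn \<Phi> f) s \<le> rearr (\<lambda>x. a + v x) s"
        by (rule rearr_mono_AE[OF M_leb av_leb]) (simp add: M_le)
      also have "\<dots> \<le> a + rearr v s"
        by (rule rearr_add_const_le[OF v_leb])
      finally show "rearr (maxfn \<Phi> f) s * indicator {0<..<t} s \<le> a * indicator {0<..<t} s + rearr v s * indicator {0<..<t} s"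
        by (auto simp: indicator_def)
    qed
    also have "\<dots> = ennreal t * a + set_nn_integral lborel {0<..<t} (rearr v)"
      using t by (simp add: nn_integral_add nn_integral_cmult_indicator mult.commute)
    also have "\<dots> \<le> ennreal t * a + ennreal t * (ennreal D * (ennreal c * S))"
      by (intro add_left_mono order_trans[OF set_nn_integral_rearr_le v]) measurable
    \<comment> \<open>The constant a accounts for \<open>D * c + c\<close>, the integral of v for
      the other \<open>D * c\<close>.\<close>
    also have "\<dots> = (ennreal (2 * D * c + c) * S) * ennreal t"
    proof -
      have "ennreal (2 * D * c + c) = ennreal D * ennreal c + ennreal D * ennreal c + ennreal c"
        using D c by (simp add: ennreal_mult[symmetric] ennreal_plus[symmetric] del: ennreal_plus)
      then show ?thesis
        unfolding a_def by (simp add: algebra_simps)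
    qed
    finally have "rearr2 (maxfn \<Phi> f) t \<le> (ennreal (2 * D * c + c) * S) * ennreal t / ennreal t"
      unfolding rearr2_def by (rule divide_right_mono_ennreal)
    with t show "rearr2 (maxfn \<Phi> f) t \<le> ennreal (2 * D * c + c) * K3fun ?n \<Phi> f t"
      by (simp add: ennreal_mult_divide_eq S_def)
  qed
qed

lemma rearr_cong_AE:
  assumes "f \<in> borel_measurable lebesgue" "g \<in> borel_measurable lebesgue"
    and "AE x in lebesgue. f x = g x"
  shows "rearr f = rearr g"
  using assms by (intro ext order_antisym rearr_mono_AE) auto

lemma K3fun_mono_AE:
  assumes [measurable]: "f \<in> borel_measurable lebesgue" "g \<in> borel_measurable lebesgue"
    and "AE x in lebesgue. \<bar>f x\<bar> \<le> \<bar>g x\<bar>"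
  shows "K3fun n \<Phi> f t \<le> K3fun n \<Phi> g t"
  unfolding K3fun_def using assms(3)
  by (intro SUP_mono' mult_left_mono rearr2_mono_AE) (auto intro: ennreal_leI)

lemma K3fun_cmult:
  assumes [measurable]: "f \<in> borel_measurable lebesgue" and "0 \<le> a"
  shows "K3fun n \<Phi> (\<lambda>x. a * f x) t = ennreal a * K3fun n \<Phi> f t"
proof -
  have "rearr2 (\<lambda>x. ennreal \<bar>a * f x\<bar>) s = ennreal a * rearr2 (\<lambda>x. ennreal \<bar>f x\<bar>) s" for s
    using assms(2) by (simp add: abs_mult ennreal_mult' rearr2_cmult)
  then show ?thesis
    unfolding K3fun_def SUP_mult_left_ennreal by (simp add: ac_simps)
qed

text \<open>A Borel representative differs from f on a null set, which neither the maximal function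
  nor the rearrangement detects.\<close>

lemma rearr2_maxfn_le_K3fun:
  assumes "class_B DIM('a::euclidean_space) \<Phi>"
  obtains C where "0 < C"
    "\<And>(f::'a \<Rightarrow> real) t. f \<in> borel_measurable lebesgue \<Longrightarrow> 0 < t \<Longrightarrow>
      rearr2 (maxfn \<Phi> f) t \<le> ennreal C * K3fun DIM('a) \<Phi> f t"
proof -
  obtain C where C: "0 < C"
    "\<And>(f::'a \<Rightarrow> real) t. f \<in> borel_measurable borel \<Longrightarrow> 0 < t \<Longrightarrow>
      rearr2 (maxfn \<Phi> f) t \<le> ennreal C * K3fun DIM('a) \<Phi> f t"
    using rearr2_maxfn_le_K3fun_borel[OF assms] by blast
  show ?thesis
  proof
    fix f :: "'a \<Rightarrow> real" and t :: real
    assume f [measurable]: "f \<in> borel_measurable lebesgue" and t: "0 < t"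
    obtain f' where f': "f' \<in> borel_measurable lborel" and "AE x in lborel. f x = f' x"
      using completion_ex_borel_measurable_real[OF f] by blast
    then have eq: "AE x in lebesgue. f x = f' x" by (simp add: AE_completion)
    have [measurable]: "f' \<in> borel_measurable lebesgue" using f' by (simp add: measurable_completion)
    have "rearr (\<lambda>x. ennreal \<bar>f x\<bar>) = rearr (\<lambda>x. ennreal \<bar>f' x\<bar>)"
      using eq by (intro rearr_cong_AE) auto
    then have "K3fun DIM('a) \<Phi> f t = K3fun DIM('a) \<Phi> f' t"
      by (simp add: K3fun_def rearr2_def)
    then show "rearr2 (maxfn \<Phi> f) t \<le> ennreal C * K3fun DIM('a) \<Phi> f t"
      using C(2)[of f' t] f' t maxfn_cong_AE[OF eq, of \<Phi>] by simp
  qed (rule C)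
qed

subsection \<open>Radial rearrangement\<close>

lemma
  assumes "banach_function_norm \<rho>"
  shows bfn_eq_0_iff: "f \<in> borel_measurable lebesgue \<Longrightarrow> \<rho> f = 0 \<longleftrightarrow> (AE x in lebesgue. f x = 0)"
    and bfn_cmult: "f \<in> borel_measurable lebesgue \<Longrightarrow> 0 \<le> a \<Longrightarrow> \<rho> (\<lambda>x. ennreal a * f x) = ennreal a * \<rho> f"
    and bfn_add: "f \<in> borel_measurable lebesgue \<Longrightarrow> g \<in> borel_measurable lebesgue \<Longrightarrow>
      \<rho> (\<lambda>x. f x + g x) \<le> \<rho> f + \<rho> g"
    and bfn_mono: "f \<in> borel_measurable lebesgue \<Longrightarrow> g \<in> borel_measurable lebesgue \<Longrightarrow>
      AE x in lebesgue. g x \<le> f x \<Longrightarrow> \<rho> g \<le> \<rho> f"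
    and bfn_SUP: "(\<And>k::nat. fs k \<in> borel_measurable lebesgue) \<Longrightarrow> f \<in> borel_measurable lebesgue \<Longrightarrow>
      AE x in lebesgue. incseq (\<lambda>k. fs k x) \<and> (SUP k. fs k x) = f x \<Longrightarrow> \<rho> f = (SUP k. \<rho> (fs k))"
    and bfn_indicator: "A \<in> sets lebesgue \<Longrightarrow> emeasure lebesgue A < \<infinity> \<Longrightarrow> \<rho> (indicator A) < \<infinity>"
    and bfn_integral: "A \<in> sets lebesgue \<Longrightarrow> emeasure lebesgue A < \<infinity> \<Longrightarrow>
      \<exists>C::real. \<forall>f \<in> borel_measurable lebesgue. set_nn_integral lebesgue A f \<le> ennreal C * \<rho> f"
  using assms unfolding banach_function_norm_def by blast+

lemma ri_norm_bfn: "ri_norm \<rho> \<Longrightarrow> banach_function_norm \<rho>"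
  and ri_norm_mono: "ri_norm \<rho> \<Longrightarrow> f \<in> borel_measurable lebesgue \<Longrightarrow> g \<in> borel_measurable lebesgue \<Longrightarrow>
    (\<And>t. 0 < t \<Longrightarrow> rearr f t \<le> rearr g t) \<Longrightarrow> \<rho> f \<le> \<rho> g"
  unfolding ri_norm_def by blast+

lemma ball_with_measure:
  assumes "0 < s"
  shows "emeasure lborel (ball (x::'a::euclidean_space) (root DIM('a) (s / unit_ball_vol DIM('a)))) = ennreal s"
  using assms unit_ball_vol_pos[of "real DIM('a)"] by (simp add: emeasure_ball less_imp_neq[symmetric])

text \<open>If the value at s were infinite, the rearrangement of f would dominate that of y times
  the indicator of a ball of measure s, for every y. Then all multiples of the positive norm of this
  indicator would stay below the finite norm of f.\<close>

lemma rearr_Espace_finite: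
  fixes \<rho> :: "('a::euclidean_space \<Rightarrow> ennreal) \<Rightarrow> ennreal"
  assumes ri: "ri_norm \<rho>" and f: "f \<in> Espace \<rho>" and s: "0 < s"
  shows "rearr (\<lambda>x. ennreal \<bar>f x\<bar>) s < \<infinity>"
proof (rule ccontr)
  define g where "g = (\<lambda>x. ennreal \<bar>f x\<bar>)"
  assume "\<not> rearr (\<lambda>x. ennreal \<bar>f x\<bar>) s < \<infinity>"
  then have top: "rearr g s = top" by (simp add: g_def top.not_eq_extremum[symmetric])
  have fin: "\<rho> g < \<infinity>" and [measurable]: "g \<in> borel_measurable lebesgue"
    using f by (auto simp: Espace_def g_def)
  note bfn = ri_norm_bfn[OF ri]
  define B where "B = ball (0::'a) (root DIM('a) (s / unit_ball_vol DIM('a)))"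
  have [measurable]: "B \<in> sets lebesgue" by (simp add: B_def)
  have B: "emeasure lebesgue B = ennreal s" using ball_with_measure[OF s, of "0::'a"] by (simp add: B_def)
  have le: "ennreal y * \<rho> (indicator B) \<le> \<rho> g" if "0 \<le> y" for y
  proof -
    have [measurable]: "(\<lambda>x. ennreal y * indicator B x) \<in> borel_measurable lebesgue" by measurable
    have "\<rho> (\<lambda>x. ennreal y * indicator B x) \<le> \<rho> g"
    proof (rule ri_norm_mono[OF ri])
      fix t :: real assume "0 < t"
      show "rearr (\<lambda>x. ennreal y * indicator B x) t \<le> rearr g t"
      proof (cases "t \<le> s")
        case True
        with rearr_antimono[OF True, of g] top show ?thesis by (simp add: top_unique)
      next
        case False
        have "emeasure lebesgue {x. rearr g t < ennreal y * indicator B x} \<le> emeasure lebesgue B"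
          by (intro emeasure_mono) (auto simp: indicator_def split: if_splits)
        also have "\<dots> \<le> ennreal t" using False by (simp add: B ennreal_leI)
        finally show ?thesis by (simp add: rearr_le_iff)
      qed
    qed auto
    then show ?thesis using bfn_cmult[OF bfn, of "indicator B" y] that by simp
  qed
  have "\<rho> (indicator B) \<noteq> 0"
  proof
    assume "\<rho> (indicator B) = 0"
    then have "AE x in lebesgue. (indicator B x :: ennreal) = 0" by (simp add: bfn_eq_0_iff[OF bfn])
    then have "AE x in lebesgue. x \<notin> B" by (auto simp: indicator_eq_0_iff)
    then have "emeasure lebesgue B = 0" by (simp add: AE_iff_measurable[of B])
    with B s show False by simp
  qed
  moreover have "\<rho> (indicator B) < \<infinity>"
    by (rule bfn_indicator[OF bfn]) (auto simp: B)
  ultimately obtain b where b: "\<rho> (indicator B) = ennreal b" "0 < b"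
    by (cases "\<rho> (indicator B)") (auto simp: ennreal_eq_0_iff)
  obtain G where G: "\<rho> g = ennreal G" "0 \<le> G" using fin by (cases "\<rho> g") auto
  \<comment> \<open>With this multiple the left side exceeds G by b.\<close>
  have "ennreal ((G / b + 1) * b) \<le> ennreal G"
    using le[of "G / b + 1"] b G by (simp add: ennreal_mult'')
  then have "(G / b + 1) * b \<le> G" using G by simp
  moreover have "(G / b + 1) * b = G + b" using b by (simp add: field_simps)
  ultimately show False using b by simp
qed

text \<open>The value at the origin is irrelevant; it is \<open>0\<close> if \<open>f\<close> is essentially unbounded, because \<open>enn2real \<infinity> = 0\<close>.\<close>
definition radial_rearr :: "('a::euclidean_space \<Rightarrow> real) \<Rightarrow> 'a \<Rightarrow> real" where
  "radial_rearr f x = enn2real (rearr (\<lambda>x. ennreal \<bar>f x\<bar>) (unit_ball_vol DIM('a) * norm x ^ DIM('a)))"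

lemma radial_rearr_measurable:
  fixes f :: "'a::euclidean_space \<Rightarrow> real"
  assumes [measurable]: "f \<in> borel_measurable lebesgue"
  shows "radial_rearr f \<in> borel_measurable borel"
proof -
  have [measurable]: "rearr (\<lambda>x. ennreal \<bar>f x\<bar>) \<in> borel_measurable borel"
    by (rule borel_measurable_rearr) measurable
  show ?thesis unfolding radial_rearr_def by measurable
qed

text \<open>The change of variables of \<open>nn_integral_norm_power\<close> preserves measures of
  superlevel sets. Only an inequality is claimed, as \<open>enn2real\<close> sends infinite values
  to 0; it suffices for the norm bound.\<close>

lemma rearr_radial_rearr_le:
  fixes f :: "'a::euclidean_space \<Rightarrow> real"
  assumes [measurable]: "f \<in> borel_measurable lebesgue"
  shows "rearr (\<lambda>x. ennreal \<bar>radial_rearr f x\<bar>) t \<le> rearr (\<lambda>x. ennreal \<bar>f x\<bar>) t"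
proof -
  define g where "g = (\<lambda>x. ennreal \<bar>f x\<bar>)"
  have g: "g \<in> borel_measurable lebesgue" unfolding g_def by measurable
  have [measurable]: "rearr g \<in> borel_measurable borel" by (rule borel_measurable_rearr[OF g])
  have [measurable]: "radial_rearr f \<in> borel_measurable lebesgue"
    using radial_rearr_measurable[OF assms] by (simp add: measurable_completion)
  let ?w = "unit_ball_vol (real DIM('a))"
  let ?z = "rearr g t"
  have "ennreal \<bar>radial_rearr f x\<bar> \<le> rearr g (?w * norm x ^ DIM('a))" for x
    unfolding radial_rearr_def g_def[symmetric] by (simp add: ennreal_enn2real_if)
  then have "emeasure lebesgue {x. ?z < ennreal \<bar>radial_rearr f x\<bar>}
      \<le> emeasure lebesgue {x. ?z < rearr g (?w * norm (x::'a) ^ DIM('a))}"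
    by (intro emeasure_mono sets_completionI_sets) (auto intro: less_le_trans)
  also have "\<dots> = (\<integral>\<^sup>+x. indicator {s. ?z < rearr g s} (?w * norm (x::'a) ^ DIM('a)) \<partial>lborel)"
  proof -
    have [measurable]: "{x. ?z < rearr g (?w * norm (x::'a) ^ DIM('a))} \<in> sets borel" by measurable
    have "emeasure lebesgue {x. ?z < rearr g (?w * norm (x::'a) ^ DIM('a))}
        = (\<integral>\<^sup>+x. indicator {x. ?z < rearr g (?w * norm (x::'a) ^ DIM('a))} x \<partial>lborel)"
      by simp
    also have "\<dots> = (\<integral>\<^sup>+x. indicator {s. ?z < rearr g s} (?w * norm (x::'a) ^ DIM('a)) \<partial>lborel)"
      by (rule nn_integral_cong) (simp add: indicator_def)
    finally show ?thesis .
  qed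
  also have "\<dots> = (\<integral>\<^sup>+s. indicator {s. ?z < rearr g s} s * indicator {0<..} s \<partial>lborel)"
    by (rule nn_integral_norm_power) measurable
  also have "\<dots> = (\<integral>\<^sup>+s. indicator {s. 0 < s \<and> ennreal s < emeasure lebesgue {x. ?z < g x}} s \<partial>lborel)"
    by (rule nn_integral_cong) (auto simp: indicator_def less_rearr_iff[OF g])
  also have "\<dots> = emeasure lborel {s. 0 < s \<and> ennreal s < emeasure lebesgue {x. ?z < g x}}"
    by (rule nn_integral_indicator) measurable
  also have "\<dots> = emeasure lebesgue {x. ?z < g x}"
    by (rule emeasure_lborel_Ioo_ennreal)
  also have "\<dots> \<le> ennreal t"
    using rearr_le_iff[OF g, of t ?z] by simp
  finally show ?thesis by (simp add: rearr_le_iff g_def)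
qed

lemma
  fixes \<rho> :: "('a::euclidean_space \<Rightarrow> ennreal) \<Rightarrow> ennreal"
  assumes ri: "ri_norm \<rho>" and f: "f \<in> Espace \<rho>"
  shows radial_rearr_Espace: "radial_rearr f \<in> Espace \<rho>"
    and Enorm_radial_rearr_le: "Enorm \<rho> (radial_rearr f) \<le> Enorm \<rho> f"
proof -
  have [measurable]: "f \<in> borel_measurable lebesgue" using f by (simp add: Espace_def)
  have [measurable]: "radial_rearr f \<in> borel_measurable lebesgue"
    using radial_rearr_measurable[of f] by (simp add: measurable_completion)
  show *: "Enorm \<rho> (radial_rearr f) \<le> Enorm \<rho> f"
    unfolding Enorm_def by (rule ri_norm_mono[OF ri]) (auto intro: rearr_radial_rearr_le)
  show "radial_rearr f \<in> Espace \<rho>"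
    using * f by (auto simp: Espace_def Enorm_def intro: le_less_trans)
qed

text \<open>The same change of variables maps the punctured ball of measure s to (0, s). Membership
  in E makes the rearrangement finite at positive arguments, so \<open>enn2real\<close> loses
  nothing away from the origin.\<close>

lemma set_nn_integral_radial_rearr:
  fixes \<rho> :: "('a::euclidean_space \<Rightarrow> ennreal) \<Rightarrow> ennreal"
  assumes ri: "ri_norm \<rho>" and f: "f \<in> Espace \<rho>" and s: "0 < s"
  shows "set_nn_integral lebesgue (ball 0 (root DIM('a) (s / unit_ball_vol DIM('a)))) (\<lambda>x. ennreal \<bar>radial_rearr f x\<bar>)
    = set_nn_integral lborel {0<..<s} (rearr (\<lambda>x. ennreal \<bar>f x\<bar>))"
proof -
  define g where "g = (\<lambda>x. ennreal \<bar>f x\<bar>)"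
  have g: "g \<in> borel_measurable lebesgue" using f unfolding g_def by (auto simp: Espace_def)
  have [measurable]: "rearr g \<in> borel_measurable borel" by (rule borel_measurable_rearr[OF g])
  let ?w = "unit_ball_vol (real DIM('a))"
  have w: "0 < ?w" by simp
  let ?F = "\<lambda>u. rearr g u * indicator {..<s} u"
  have ball: "x \<in> ball 0 (root DIM('a) (s / ?w)) \<longleftrightarrow> ?w * norm x ^ DIM('a) < s" for x :: 'a
  proof -
    have "root DIM('a) (s / ?w) \<le> norm x \<longleftrightarrow> root DIM('a) (s / ?w) ^ DIM('a) \<le> norm x ^ DIM('a)"
      using s w by (intro power_mono_iff[symmetric]) auto
    then have "norm x < root DIM('a) (s / ?w) \<longleftrightarrow> norm x ^ DIM('a) < root DIM('a) (s / ?w) ^ DIM('a)"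
      by (simp only: not_le[symmetric])
    with s w show ?thesis by (simp add: field_simps)
  qed
  have "set_nn_integral lebesgue (ball 0 (root DIM('a) (s / ?w))) (\<lambda>x. ennreal \<bar>radial_rearr f x\<bar>)
      = (\<integral>\<^sup>+x. ?F (?w * norm (x::'a) ^ DIM('a)) \<partial>lborel)"
    unfolding nn_integral_completion
  proof (rule nn_integral_cong_AE)
    have "AE x in lborel. x \<noteq> (0::'a)" by (rule AE_lborel_singleton)
    then show "AE x in lborel. ennreal \<bar>radial_rearr f x\<bar> * indicator (ball 0 (root DIM('a) (s / ?w))) x
        = ?F (?w * norm (x::'a) ^ DIM('a))"
    proof eventually_elim
      case (elim x)
      then have "rearr g (?w * norm x ^ DIM('a)) < \<infinity>"
        using rearr_Espace_finite[OF ri f] w by (simp add: g_def)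
      then show ?case
        using ball[of x] by (simp add: radial_rearr_def g_def indicator_def)
    qed
  qed
  also have "\<dots> = set_nn_integral lborel {0<..} ?F"
    by (rule nn_integral_norm_power) measurable
  also have "\<dots> = set_nn_integral lborel {0<..<s} (rearr g)"
    by (intro nn_integral_cong) (auto simp: indicator_def)
  finally show ?thesis unfolding g_def .
qed

text \<open>The local integrability axiom of the norm, applied to \<open>radial_rearr f\<close> on
  the ball of measure s.\<close>

lemma set_nn_integral_rearr_finite:
  fixes \<rho> :: "('a::euclidean_space \<Rightarrow> ennreal) \<Rightarrow> ennreal"
  assumes ri: "ri_norm \<rho>" and f: "f \<in> Espace \<rho>" and s: "0 < s"
  shows "set_nn_integral lborel {0<..<s} (rearr (\<lambda>x. ennreal \<bar>f x\<bar>)) < \<infinity>"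
proof -
  let ?B = "ball (0::'a) (root DIM('a) (s / unit_ball_vol DIM('a)))"
  obtain C where C: "\<And>h. h \<in> borel_measurable lebesgue \<Longrightarrow> set_nn_integral lebesgue ?B h \<le> ennreal C * \<rho> h"
    using bfn_integral[OF ri_norm_bfn[OF ri], of ?B] ball_with_measure[OF s, of "0::'a"] by auto
  have E: "radial_rearr f \<in> borel_measurable lebesgue" "\<rho> (\<lambda>x. ennreal \<bar>radial_rearr f x\<bar>) < \<infinity>"
    using radial_rearr_Espace[OF ri f] by (auto simp: Espace_def)
  have "set_nn_integral lebesgue ?B (\<lambda>x. ennreal \<bar>radial_rearr f x\<bar>) \<le> ennreal C * \<rho> (\<lambda>x. ennreal \<bar>radial_rearr f x\<bar>)"
    using E(1) by (intro C) measurable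
  also have "\<dots> < \<infinity>" using E(2) by (simp add: ennreal_mult_less_top)
  finally show ?thesis unfolding set_nn_integral_radial_rearr[OF ri f s] .
qed

text \<open>For each \<tau> above t the maximal function of \<open>radial_rearr f\<close> is large
  on a whole ball of measure \<tau>, so its rearrangement at t is at least as large.\<close>

lemma K3fun_le_rearr_maxfn:
  fixes \<rho> :: "('a::euclidean_space \<Rightarrow> ennreal) \<Rightarrow> ennreal"
  assumes ri: "ri_norm \<rho>" and \<Phi>: "class_B DIM('a) \<Phi>"
  obtains C where "0 < C"
    "\<And>f t. f \<in> Espace \<rho> \<Longrightarrow> 0 < t \<Longrightarrow> K3fun DIM('a) \<Phi> f t \<le> ennreal C * rearr (maxfn \<Phi> (radial_rearr f)) t"
proof -
  let ?n = "DIM('a)"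
  let ?w = "unit_ball_vol (real ?n)"
  have w: "0 < ?w" by simp
  \<comment> \<open>The ball of measure \<tau> has radius r with 2 * r equal to
    \<open>2 / root ?n ?w\<close> times the root of \<tau>; the maximum with 1 makes doubling
    applicable.\<close>
  define l where "l = max 1 (2 / root ?n ?w)"
  obtain c where c: "0 < c" "\<And>r. 0 < r \<Longrightarrow> \<Phi> r \<le> c * \<Phi> (l * r)"
    using class_B_doubling[OF \<Phi>, of l] by (auto simp: l_def)
  show ?thesis
  proof
    fix f t assume f: "f \<in> Espace \<rho>" and t: "0 < (t::real)"
    define z where "z = rearr (maxfn \<Phi> (radial_rearr f)) t"
    have "radial_rearr f \<in> borel_measurable lebesgue"
      using radial_rearr_Espace[OF ri f] by (simp add: Espace_def)
    then have M: "maxfn \<Phi> (radial_rearr f) \<in> borel_measurable lebesgue"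
      using borel_measurable_maxfn[of "radial_rearr f" \<Phi>] by (simp add: measurable_completion)
    show "K3fun ?n \<Phi> f t \<le> ennreal c * rearr (maxfn \<Phi> (radial_rearr f)) t"
      unfolding K3fun_eq[OF t] z_def[symmetric]
    proof (rule SUP_least)
      fix \<tau> assume "\<tau> \<in> {t<..}"
      with t have \<tau>: "t < \<tau>" "0 < \<tau>" by auto
      define I where "I = set_nn_integral lborel {0<..<\<tau>} (rearr (\<lambda>x. ennreal \<bar>f x\<bar>))"
      define r where "r = root ?n (\<tau> / ?w)"
      have r: "0 < r" using \<tau> w by (simp add: r_def)
      have ball: "emeasure lborel (ball (0::'a) r) = ennreal \<tau>"
        unfolding r_def by (rule ball_with_measure[OF \<tau>(2)])
      have I: "I = set_nn_integral lebesgue (ball 0 r) (\<lambda>x. ennreal \<bar>radial_rearr f x\<bar>)"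
        unfolding I_def r_def by (rule set_nn_integral_radial_rearr[OF ri f \<tau>(2), symmetric])
      have M_ge: "ennreal (\<Phi> (2 * r)) * I \<le> maxfn \<Phi> (radial_rearr f) x" if "x \<in> ball 0 r" for x
      proof -
        have "ball 0 r \<subseteq> ball x (2 * r)"
        proof
          fix y :: 'a assume "y \<in> ball 0 r"
          with that dist_triangle[of x y 0] show "y \<in> ball x (2 * r)" by (simp add: dist_commute)
        qed
        then have "I \<le> set_nn_integral lebesgue (ball x (2 * r)) (\<lambda>x. ennreal \<bar>radial_rearr f x\<bar>)"
          unfolding I by (intro nn_integral_mono) (auto simp: indicator_def)
        then show ?thesis
          unfolding maxfn_def using r by (intro SUP_upper2[of "2 * r"] mult_left_mono) auto
      qed
      \<comment> \<open>Otherwise a ball of measure \<tau> would lie in a superlevel set of measure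
        at most t.\<close>
      have "ennreal (\<Phi> (2 * r)) * I \<le> z"
      proof (rule ccontr)
        assume "\<not> ennreal (\<Phi> (2 * r)) * I \<le> z"
        then have "ball 0 r \<subseteq> {x. z < maxfn \<Phi> (radial_rearr f) x}"
          using M_ge by (auto simp: not_le intro: less_le_trans)
        then have "emeasure lebesgue (ball (0::'a) r) \<le> emeasure lebesgue {x. z < maxfn \<Phi> (radial_rearr f) x}"
          by (intro emeasure_mono sets_lebesgue_superlevel M)
        also have "\<dots> \<le> ennreal t"
          using rearr_le_iff[OF M, of t z] by (simp add: z_def)
        finally have "ennreal \<tau> \<le> ennreal t" using ball by simp
        with \<tau> t show False by simp
      qed
      moreover have "\<Phi> (root ?n \<tau>) \<le> c * \<Phi> (2 * r)"
      proof -
        have "2 * r \<le> l * root ?n \<tau>"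
          using \<tau> w mult_right_mono[of "2 / root ?n ?w" l "root ?n \<tau>"]
          by (simp add: l_def r_def real_root_divide)
        then have "\<Phi> (l * root ?n \<tau>) \<le> \<Phi> (2 * r)"
          using r by (intro class_B_antimono[OF \<Phi>]) auto
        then have "c * \<Phi> (l * root ?n \<tau>) \<le> c * \<Phi> (2 * r)" using c by simp
        moreover have "\<Phi> (root ?n \<tau>) \<le> c * \<Phi> (l * root ?n \<tau>)" using \<tau> by (intro c) simp
        ultimately show ?thesis by linarith
      qed
      then have "ennreal (\<Phi> (root ?n \<tau>)) * I \<le> ennreal c * (ennreal (\<Phi> (2 * r)) * I)"
        using c by (simp add: mult.assoc[symmetric] ennreal_mult'[symmetric] mult_right_mono ennreal_leI)
      ultimately show "ennreal (\<Phi> (root ?n \<tau>)) * set_nn_integral lborel {0<..<\<tau>} (rearr (\<lambda>x. ennreal \<bar>f x\<bar>)) \<le> ennreal c * z"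
        unfolding I_def[symmetric] by (meson mult_left_mono order_trans zero_le)
    qed
  qed (rule c)
qed

text \<open>Terms of the supremum with \<tau> up to s have the common finite bound b, and the
  remaining ones belong to the supremum from s. Thus an infinite value at one point spreads to all,
  as \<open>covered_by_cone\<close> will require.\<close>

lemma K3fun_eq_top:
  fixes \<rho> :: "('a::euclidean_space \<Rightarrow> ennreal) \<Rightarrow> ennreal"
  assumes ri: "ri_norm \<rho>" and \<Phi>: "class_B DIM('a) \<Phi>" and f: "f \<in> Espace \<rho>"
    and t: "0 < t" "K3fun DIM('a) \<Phi> f t = \<infinity>" and s: "0 < s"
  shows "K3fun DIM('a) \<Phi> f s = \<infinity>"
proof -
  let ?n = "DIM('a)"
  define I where "I s = set_nn_integral lborel {0<..<s} (rearr (\<lambda>x. ennreal \<bar>f x\<bar>))" for s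
  have I_mono: "I u \<le> I v" if "u \<le> v" for u v
    unfolding I_def using that by (intro nn_integral_mono mult_left_mono) (auto simp: indicator_def)
  define b where "b = ennreal (\<Phi> (root ?n t)) * I s"
  have "K3fun ?n \<Phi> f t \<le> max b (K3fun ?n \<Phi> f s)"
    unfolding K3fun_eq[OF t(1)] I_def[symmetric]
  proof (rule SUP_least)
    fix \<tau> assume "\<tau> \<in> {t<..}"
    then have \<tau>: "t < \<tau>" by simp
    show "ennreal (\<Phi> (root ?n \<tau>)) * I \<tau> \<le> max b (K3fun ?n \<Phi> f s)"
    proof (cases "\<tau> \<le> s")
      case True
      have "ennreal (\<Phi> (root ?n \<tau>)) * I \<tau> \<le> b"
        unfolding b_def using t(1) \<tau> True
        by (intro mult_mono ennreal_leI I_mono class_B_antimono[OF \<Phi>]) auto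
      then show ?thesis by (simp add: le_max_iff_disj)
    next
      case False
      then have "ennreal (\<Phi> (root ?n \<tau>)) * I \<tau> \<le> K3fun ?n \<Phi> f s"
        unfolding K3fun_eq[OF s] I_def[symmetric] by (intro SUP_upper) auto
      then show ?thesis by (simp add: le_max_iff_disj)
    qed
  qed
  moreover have "b < \<infinity>"
    unfolding b_def I_def using set_nn_integral_rearr_finite[OF ri f s] by (simp add: ennreal_mult_less_top)
  ultimately show ?thesis
    using t(2) by (simp add: top_unique max_def split: if_splits)
qed

subsection \<open>Coverings of cones\<close>

text \<open>Abstracting the map T lets one covering lemma serve all three cones.\<close>

definition cone :: "(('a::euclidean_space \<Rightarrow> ennreal) \<Rightarrow> ennreal) \<Rightarrow> (('a \<Rightarrow> real) \<Rightarrow> real \<Rightarrow> ennreal)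
    \<Rightarrow> (real \<Rightarrow> ennreal) set" where
  "cone \<rho> T = {h. \<exists>f \<in> Espace \<rho>. \<forall>t>0. h t = T f t}"

definition cone_gauge :: "(('a::euclidean_space \<Rightarrow> ennreal) \<Rightarrow> ennreal) \<Rightarrow> (('a \<Rightarrow> real) \<Rightarrow> real \<Rightarrow> ennreal)
    \<Rightarrow> (real \<Rightarrow> ennreal) \<Rightarrow> ennreal" where
  "cone_gauge \<rho> T h = (INF f\<in>{f \<in> Espace \<rho>. \<forall>t>0. T f t = h t}. Enorm \<rho> f)"

lemma Espace_locally_integrable:
  fixes \<rho> :: "('a::euclidean_space \<Rightarrow> ennreal) \<Rightarrow> ennreal"
  assumes "banach_function_norm \<rho>" "f \<in> Espace \<rho>"
  shows "locally_integrable f"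
  unfolding locally_integrable_def
proof (intro allI impI)
  fix K :: "'a set" assume K: "compact K"
  then have [measurable]: "K \<in> sets lebesgue" by (simp add: compact_imp_closed borel_closed)
  have [measurable]: "f \<in> borel_measurable lebesgue" using assms(2) by (simp add: Espace_def)
  have "emeasure lebesgue K < \<infinity>"
    using emeasure_compact_finite[OF K] K by (simp add: compact_imp_closed borel_closed)
  from bfn_integral[OF assms(1) _ this] obtain C where
    "\<And>h. h \<in> borel_measurable lebesgue \<Longrightarrow> set_nn_integral lebesgue K h \<le> ennreal C * \<rho> h"
    by auto
  then have "set_nn_integral lebesgue K (\<lambda>x. ennreal \<bar>f x\<bar>) \<le> ennreal C * \<rho> (\<lambda>x. ennreal \<bar>f x\<bar>)"
    by simp
  also have "\<dots> < \<infinity>" using assms(2) by (simp add: ennreal_mult_less_top Espace_def)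
  finally have "set_nn_integral lebesgue K (\<lambda>x. ennreal \<bar>f x\<bar>) < \<infinity>" .
  then have "(\<integral>\<^sup>+x. ennreal (norm (indicator K x *\<^sub>R f x)) \<partial>lebesgue) < \<infinity>"
    by (rule le_less_trans[rotated]) (auto intro!: nn_integral_mono simp: indicator_def)
  then show "set_integrable lebesgue K f"
    unfolding set_integrable_def by (intro integrableI_bounded) measurable
qed

text \<open>The infimum over u and the inner one over f with maximal function u merge into one
  infimum over f; local integrability is automatic in E.\<close>

lemma
  assumes "banach_function_norm \<rho>"
  shows K1_eq_cone: "K1 \<rho> \<Phi> = cone \<rho> (\<lambda>f. rearr (maxfn \<Phi> f))"
    and K2_eq_cone: "K2 \<rho> \<Phi> = cone \<rho> (\<lambda>f. rearr2 (maxfn \<Phi> f))"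
    and rhoK1_eq_gauge: "rhoK1 \<rho> \<Phi> = cone_gauge \<rho> (\<lambda>f. rearr (maxfn \<Phi> f))"
    and rhoK2_eq_gauge: "rhoK2 \<rho> \<Phi> = cone_gauge \<rho> (\<lambda>f. rearr2 (maxfn \<Phi> f))"
proof -
  note li = Espace_locally_integrable[OF assms]
  have gauge: "(INF u\<in>{u \<in> MEspace \<rho> \<Phi>. P u}. MEnorm \<rho> \<Phi> u) = (INF f\<in>{f \<in> Espace \<rho>. P (maxfn \<Phi> f)}. Enorm \<rho> f)" for P
  proof (rule antisym)
    show "(INF u\<in>{u \<in> MEspace \<rho> \<Phi>. P u}. MEnorm \<rho> \<Phi> u) \<le> (INF f\<in>{f \<in> Espace \<rho>. P (maxfn \<Phi> f)}. Enorm \<rho> f)"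
    proof (rule INF_greatest)
      fix f assume f: "f \<in> {f \<in> Espace \<rho>. P (maxfn \<Phi> f)}"
      have "(INF u\<in>{u \<in> MEspace \<rho> \<Phi>. P u}. MEnorm \<rho> \<Phi> u) \<le> MEnorm \<rho> \<Phi> (maxfn \<Phi> f)"
        using f li by (intro INF_lower) (auto simp: MEspace_def)
      also have "\<dots> \<le> Enorm \<rho> f"
        unfolding MEnorm_def using f li by (intro INF_lower) auto
      finally show "(INF u\<in>{u \<in> MEspace \<rho> \<Phi>. P u}. MEnorm \<rho> \<Phi> u) \<le> Enorm \<rho> f" .
    qed
    show "(INF f\<in>{f \<in> Espace \<rho>. P (maxfn \<Phi> f)}. Enorm \<rho> f) \<le> (INF u\<in>{u \<in> MEspace \<rho> \<Phi>. P u}. MEnorm \<rho> \<Phi> u)"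
      unfolding MEnorm_def by (intro INF_greatest INF_lower) auto
  qed
  show "rhoK1 \<rho> \<Phi> = cone_gauge \<rho> (\<lambda>f. rearr (maxfn \<Phi> f))"
    by (rule ext) (simp add: rhoK1_def cone_gauge_def gauge)
  show "rhoK2 \<rho> \<Phi> = cone_gauge \<rho> (\<lambda>f. rearr2 (maxfn \<Phi> f))"
    by (rule ext) (simp add: rhoK2_def cone_gauge_def gauge)
  show "K1 \<rho> \<Phi> = cone \<rho> (\<lambda>f. rearr (maxfn \<Phi> f))" "K2 \<rho> \<Phi> = cone \<rho> (\<lambda>f. rearr2 (maxfn \<Phi> f))"
    using li by (auto simp: K1_def K2_def cone_def MEspace_def)
qed

lemma K3_eq_cone: "K3 n \<rho> \<Phi> = cone \<rho> (K3fun n \<Phi>)"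
  and rhoK3_eq_gauge: "rhoK3 n \<rho> \<Phi> = cone_gauge \<rho> (K3fun n \<Phi>)"
  by (auto simp: K3_def cone_def rhoK3_def cone_gauge_def)

lemma
  assumes "banach_function_norm \<rho>" "f \<in> Espace \<rho>" "0 \<le> a"
  shows Espace_cmult: "(\<lambda>x. a * f x) \<in> Espace \<rho>"
    and Enorm_cmult: "Enorm \<rho> (\<lambda>x. a * f x) = ennreal a * Enorm \<rho> f"
proof -
  have [measurable]: "f \<in> borel_measurable lebesgue" using assms(2) by (simp add: Espace_def)
  show *: "Enorm \<rho> (\<lambda>x. a * f x) = ennreal a * Enorm \<rho> f"
    unfolding Enorm_def using assms(3)
    by (simp add: abs_mult ennreal_mult' bfn_cmult[OF assms(1)])
  then show "(\<lambda>x. a * f x) \<in> Espace \<rho>"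
    using assms(2) by (auto simp: Espace_def Enorm_def ennreal_mult_less_top)
qed

section \<open>Series in E and the covering criterion\<close>

lemma bfn_suminf_le:
  assumes bfn: "banach_function_norm \<rho>" and [measurable]: "\<And>k::nat. fs k \<in> borel_measurable lebesgue"
  shows "\<rho> (\<lambda>x. \<Sum>k. fs k x) \<le> (\<Sum>k. \<rho> (fs k))"
proof -
  have partial: "\<rho> (\<lambda>x. \<Sum>k<n. fs k x) \<le> (\<Sum>k<n. \<rho> (fs k))" for n
  proof (induction n)
    case 0
    show ?case using bfn_eq_0_iff[OF bfn, of "\<lambda>_. 0"] by simp
  next
    case (Suc n)
    have "\<rho> (\<lambda>x. (\<Sum>k<n. fs k x) + fs n x) \<le> \<rho> (\<lambda>x. \<Sum>k<n. fs k x) + \<rho> (fs n)"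
      by (rule bfn_add[OF bfn]) measurable
    with Suc show ?case by (auto intro: order_trans add_right_mono)
  qed
  \<comment> \<open>The Fatou property carries finite subadditivity to the limit of the increasing
    partial sums.\<close>
  have "\<rho> (\<lambda>x. \<Sum>k. fs k x) = (SUP n. \<rho> (\<lambda>x. \<Sum>k<n. fs k x))"
    by (rule bfn_SUP[OF bfn]) (auto simp: suminf_eq_SUP incseq_def intro!: sum_mono2)
  also have "\<dots> \<le> (\<Sum>k. \<rho> (fs k))"
    by (intro SUP_least order_trans[OF partial] sum_le_suminf) auto
  finally show ?thesis .
qed

text \<open>The norm controls integrals over balls of integer radius, and these exhaust the
  space.\<close>

lemma AE_finite_of_bfn:
  fixes \<rho> :: "('a::euclidean_space \<Rightarrow> ennreal) \<Rightarrow> ennreal"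
  assumes bfn: "banach_function_norm \<rho>" and [measurable]: "g \<in> borel_measurable lebesgue" and "\<rho> g < \<infinity>"
  shows "AE x in lebesgue. g x < \<infinity>"
proof -
  have "AE x in lebesgue. \<forall>n::nat. x \<in> ball 0 (real n) \<longrightarrow> g x < \<infinity>"
    unfolding AE_all_countable
  proof
    fix n :: nat
    let ?B = "ball (0::'a) (real n)"
    have [measurable]: "?B \<in> sets lebesgue" by simp
    have "emeasure lebesgue ?B < \<infinity>" by (simp add: emeasure_ball)
    from bfn_integral[OF bfn _ this] obtain C where
      C: "\<forall>f\<in>borel_measurable lebesgue. set_nn_integral lebesgue ?B f \<le> ennreal C * \<rho> f"
      by auto
    have "set_nn_integral lebesgue ?B g \<le> ennreal C * \<rho> g"
      using bspec[OF C assms(2)] .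
    also have "\<dots> < \<infinity>" using assms(3) by (simp add: ennreal_mult_less_top)
    finally have "AE x in lebesgue. g x * indicator ?B x \<noteq> \<infinity>"
      by (intro nn_integral_PInf_AE) auto
    then show "AE x in lebesgue. x \<in> ?B \<longrightarrow> g x < \<infinity>"
      by eventually_elim (auto simp: indicator_def less_top)
  qed
  then show ?thesis
  proof eventually_elim
    case (elim x)
    obtain n :: nat where "norm x < real n" using reals_Archimedean2 by blast
    with elim show ?case by auto
  qed
qed

text \<open>Riesz-Fischer: the sum of the absolute values has finite norm by the geometric bound,
  hence is finite almost everywhere, and \<open>enn2real\<close> changes it only on a null
  set.\<close>

lemma Espace_dominating_sequence:
  fixes \<rho> :: "('a::euclidean_space \<Rightarrow> ennreal) \<Rightarrow> ennreal"
  assumes bfn: "banach_function_norm \<rho>" and fs: "\<And>k::nat. fs k \<in> Espace \<rho>"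
    and le: "\<And>k. Enorm \<rho> (fs k) \<le> ennreal ((1/2) ^ k)"
  obtains f where "f \<in> Espace \<rho>" "\<And>k. AE x in lebesgue. \<bar>fs k x\<bar> \<le> \<bar>f x\<bar>"
proof -
  have [measurable]: "fs k \<in> borel_measurable lebesgue" for k using fs[of k] by (simp add: Espace_def)
  define g where "g x = (\<Sum>k. ennreal \<bar>fs k x\<bar>)" for x
  have [measurable]: "g \<in> borel_measurable lebesgue" unfolding g_def by measurable
  have "\<rho> g \<le> (\<Sum>k. Enorm \<rho> (fs k))"
    unfolding g_def Enorm_def by (rule bfn_suminf_le[OF bfn]) measurable
  also have "\<dots> \<le> (\<Sum>k. ennreal ((1/2) ^ k))"
    by (intro suminf_le le) auto
  also have "\<dots> < \<infinity>"
    by (subst suminf_ennreal2) auto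
  finally have fin: "\<rho> g < \<infinity>" .
  have AE: "AE x in lebesgue. g x < \<infinity>" by (rule AE_finite_of_bfn[OF bfn _ fin]) measurable
  show ?thesis
  proof
    have "\<rho> (\<lambda>x. ennreal \<bar>enn2real (g x)\<bar>) \<le> \<rho> g"
      by (rule bfn_mono[OF bfn]) (auto simp: ennreal_enn2real_if)
    with fin show "(\<lambda>x. enn2real (g x)) \<in> Espace \<rho>"
      by (auto simp: Espace_def intro: le_less_trans)
    fix k
    show "AE x in lebesgue. \<bar>fs k x\<bar> \<le> \<bar>enn2real (g x)\<bar>"
      using AE
    proof eventually_elim
      case (elim x)
      have "(\<Sum>j\<in>{k}. ennreal \<bar>fs j x\<bar>) \<le> g x"
        unfolding g_def by (rule sum_le_suminf) auto
      then have "ennreal \<bar>fs k x\<bar> \<le> g x" by simp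
      then have "enn2real (ennreal \<bar>fs k x\<bar>) \<le> enn2real (g x)"
        using elim by (intro enn2real_mono) auto
      then show ?case by simp
    qed
  qed
qed

text \<open>The infimum defining the gauge need not be attained. If it is \<open>0\<close> for some \<open>h \<noteq> 0\<close>, then a weighted sum of
  almost minimisers has infinite image wherever \<open>h\<close> is positive; this is why the hypothesis on infinite
  values is needed besides the pointwise estimate.\<close>
lemma covered_by_cone:
  fixes \<rho> :: "('a::euclidean_space \<Rightarrow> ennreal) \<Rightarrow> ennreal"
  assumes bfn: "banach_function_norm \<rho>"
    and T_mono: "\<And>f g t. f \<in> Espace \<rho> \<Longrightarrow> g \<in> Espace \<rho> \<Longrightarrow> AE x in lebesgue. \<bar>f x\<bar> \<le> \<bar>g x\<bar> \<Longrightarrow>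
      0 < t \<Longrightarrow> T f t \<le> T g t"
    and T_cmult: "\<And>f a t. f \<in> Espace \<rho> \<Longrightarrow> 0 \<le> a \<Longrightarrow> T (\<lambda>x. a * f x) t = ennreal a * T f t"
    and S_cmult: "\<And>f a t. f \<in> Espace \<rho> \<Longrightarrow> 0 \<le> a \<Longrightarrow> S (\<lambda>x. a * f x) t = ennreal a * S f t"
    and "0 < C"
    and dom: "\<And>f. f \<in> Espace \<rho> \<Longrightarrow> \<exists>g\<in>Espace \<rho>. Enorm \<rho> g \<le> ennreal C * Enorm \<rho> f \<and>
      (\<forall>t>0. T f t \<le> S g t) \<and> ((\<exists>t>0. T f t = \<infinity>) \<longrightarrow> (\<forall>t>0. S g t = \<infinity>))"
  shows "covered_by (cone \<rho> T) (cone_gauge \<rho> T) (cone \<rho> S) (cone_gauge \<rho> S)"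
  unfolding covered_by_def
\<comment> \<open>C comes from \<open>dom\<close>. The factor 2 makes up for an infimum p that may
  not be attained: for p positive and finite some f has norm below 2 * p.\<close>
proof (intro exI[of _ "2 * C"] conjI ballI)
  show "0 < 2 * C" using \<open>0 < C\<close> by simp
  fix h assume "h \<in> cone \<rho> T"
  then obtain f0 where f0: "f0 \<in> Espace \<rho>" "\<And>t. 0 < t \<Longrightarrow> T f0 t = h t" by (auto simp: cone_def)
  define p where "p = cone_gauge \<rho> T h"
  have gauge_le: "cone_gauge \<rho> S (S g) \<le> Enorm \<rho> g" "S g \<in> cone \<rho> S" if "g \<in> Espace \<rho>" for g
    using that unfolding cone_gauge_def cone_def by (auto intro: INF_lower)
  have approx: "\<exists>f\<in>Espace \<rho>. (\<forall>t>0. T f t = h t) \<and> Enorm \<rho> f < y" if "p < y" for y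
    using that unfolding p_def cone_gauge_def by (auto simp: INF_less_iff)
  show "\<exists>h2\<in>cone \<rho> S. cone_gauge \<rho> S h2 \<le> ennreal (2 * C) * cone_gauge \<rho> T h \<and> (\<forall>t>0. h t \<le> h2 t)"
  proof (cases "p = 0")
    case False
    have "p \<le> Enorm \<rho> f0" unfolding p_def cone_gauge_def using f0 by (intro INF_lower) auto
    also have "\<dots> < \<infinity>" using f0 by (simp add: Espace_def Enorm_def)
    finally have "p < 2 * p"
      using False by (cases p) (auto simp: numeral_mult_ennreal ennreal_less_iff)
    from approx[OF this] obtain f where f: "f \<in> Espace \<rho>" "\<And>t. 0 < t \<Longrightarrow> T f t = h t" "Enorm \<rho> f < 2 * p"
      by blast
    from dom[OF f(1)] obtain g where g: "g \<in> Espace \<rho>" "Enorm \<rho> g \<le> ennreal C * Enorm \<rho> f" "\<And>t. 0 < t \<Longrightarrow> T f t \<le> S g t"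
      by blast
    have "cone_gauge \<rho> S (S g) \<le> Enorm \<rho> g" by (rule gauge_le[OF g(1)])
    also have "\<dots> \<le> ennreal C * Enorm \<rho> f" by (rule g)
    also have "\<dots> \<le> ennreal C * (2 * p)" using f(3) by (intro mult_left_mono) auto
    also have "\<dots> = ennreal (2 * C) * p" using \<open>0 < C\<close> by (simp add: ennreal_mult' ac_simps)
    finally show ?thesis
      using g(3) f(2) gauge_le(2)[OF g(1)] unfolding p_def by (intro bexI[of _ "S g"]) auto
  next
    case p0: True
    show ?thesis
    proof (cases "\<forall>t>0. h t = 0")
      case True
      \<comment> \<open>The zero function, written as a multiple so that the scaling lemmas give its
        membership and norm.\<close>
      have zero: "(\<lambda>x. 0 * f0 x) \<in> Espace \<rho>" by (rule Espace_cmult[OF bfn f0(1)]) simp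
      have "cone_gauge \<rho> S (S (\<lambda>x. 0 * f0 x)) \<le> 0"
        using gauge_le(1)[OF zero] Enorm_cmult[OF bfn f0(1), of 0] by simp
      with True gauge_le(2)[OF zero] show ?thesis by (intro bexI[of _ "S (\<lambda>x. 0 * f0 x)"]) auto
    next
      case False
      then obtain t0 where t0: "0 < t0" "h t0 \<noteq> 0" by auto
      \<comment> \<open>After scaling by k + 1 the norms are still summable while the images are (k
        + 1) * h; a common majorant therefore has infinite image at t0.\<close>
      have "\<exists>f\<in>Espace \<rho>. (\<forall>t>0. T f t = h t) \<and> Enorm \<rho> f < ennreal ((1/2) ^ k / (real k + 1))" for k
        by (rule approx) (simp add: p0)
      then obtain fs where fs: "\<And>k. fs k \<in> Espace \<rho>" "\<And>k t. 0 < t \<Longrightarrow> T (fs k) t = h t"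
          "\<And>k. Enorm \<rho> (fs k) < ennreal ((1/2) ^ k / (real k + 1))"
        by metis
      define gs where "gs k = (\<lambda>x. (real k + 1) * fs k x)" for k
      have gs: "gs k \<in> Espace \<rho>" for k
        unfolding gs_def by (rule Espace_cmult[OF bfn fs(1)]) simp
      have "Enorm \<rho> (gs k) \<le> ennreal ((1/2) ^ k)" for k
      proof -
        have "Enorm \<rho> (gs k) = ennreal (real k + 1) * Enorm \<rho> (fs k)"
          unfolding gs_def by (rule Enorm_cmult[OF bfn fs(1)]) simp
        also have "\<dots> \<le> ennreal (real k + 1) * ennreal ((1/2) ^ k / (real k + 1))"
          using fs(3)[of k] by (intro mult_left_mono) auto
        also have "\<dots> = ennreal ((1/2) ^ k)"
          by (simp add: ennreal_mult'[symmetric] del: ennreal_plus)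
        finally show ?thesis .
      qed
      with gs obtain f where f: "f \<in> Espace \<rho>" "\<And>k. AE x in lebesgue. \<bar>gs k x\<bar> \<le> \<bar>f x\<bar>"
        using Espace_dominating_sequence[OF bfn] by blast
      have large: "of_nat k * h t0 \<le> T f t0" for k
      proof -
        have "of_nat k * h t0 \<le> ennreal (real k + 1) * h t0"
          by (intro mult_right_mono) (auto simp: ennreal_of_nat_eq_real_of_nat intro: ennreal_leI)
        also have "\<dots> = T (gs k) t0"
          unfolding gs_def using T_cmult[OF fs(1), of "real k + 1" k t0] fs(2)[OF t0(1)] by simp
        also have "\<dots> \<le> T f t0"
          by (rule T_mono[OF gs f(1) f(2) t0(1)])
        finally show ?thesis .
      qed
      have "T f t0 = \<infinity>"
      proof -
        have "\<infinity> = (SUP k. of_nat k :: ennreal) * h t0"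
          using t0(2) by (simp add: ennreal_SUP_of_nat_eq_top ennreal_top_mult)
        also have "\<dots> \<le> T f t0"
          unfolding SUP_mult_right_ennreal by (intro SUP_least large)
        finally show ?thesis by (simp add: top_unique)
      qed
      with t0(1) dom[OF f(1)] obtain g where g: "g \<in> Espace \<rho>" "\<And>t. 0 < t \<Longrightarrow> S g t = \<infinity>" by blast
      have fin: "Enorm \<rho> g < \<infinity>" using g(1) by (simp add: Espace_def Enorm_def)
      \<comment> \<open>The constant infinite function is unchanged by scaling, so arbitrarily small
        multiples of g represent it and its gauge vanishes.\<close>
      have small: "cone_gauge \<rho> S (\<lambda>t. \<infinity>) \<le> ennreal a * Enorm \<rho> g" if "0 < a" for a
      proof -
        have "\<forall>t>0. S (\<lambda>x. a * g x) t = \<infinity>"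
          using S_cmult[OF g(1), of a] g(2) that by (simp add: ennreal_mult_top)
        then have "cone_gauge \<rho> S (\<lambda>t. \<infinity>) \<le> Enorm \<rho> (\<lambda>x. a * g x)"
          unfolding cone_gauge_def using Espace_cmult[OF bfn g(1), of a] that by (intro INF_lower) auto
        then show ?thesis using Enorm_cmult[OF bfn g(1), of a] that by simp
      qed
      have "cone_gauge \<rho> S (\<lambda>t. \<infinity>) \<le> 0"
      proof (rule ennreal_le_epsilon)
        fix e :: real assume e: "0 < e"
        obtain b where b: "Enorm \<rho> g = ennreal b" "0 \<le> b" using fin by (cases "Enorm \<rho> g") auto
        have "cone_gauge \<rho> S (\<lambda>t. \<infinity>) \<le> ennreal (e / (b + 1)) * ennreal b"
          using small[of "e / (b + 1)"] e b by simp
        also have "\<dots> = ennreal (e * (b / (b + 1)))"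
          using b by (simp add: ennreal_mult''[symmetric])
        also have "\<dots> \<le> ennreal e"
          using e b by (intro ennreal_leI mult_left_le) auto
        finally show "cone_gauge \<rho> S (\<lambda>t. \<infinity>) \<le> 0 + ennreal e" by simp
      qed
      moreover have "(\<lambda>t. \<infinity>) \<in> cone \<rho> S" unfolding cone_def using g by (intro CollectI bexI[of _ g]) auto
      ultimately show ?thesis by (intro bexI[of _ "\<lambda>t. \<infinity>"]) auto
    qed
  qed
qed

lemma covered_by_trans:
  assumes "covered_by K \<rho>K L \<rho>L" "covered_by L \<rho>L M \<rho>M"
  shows "covered_by K \<rho>K M \<rho>M"
proof -
  obtain C where C: "C > 0" "\<And>h. h \<in> K \<Longrightarrow> \<exists>h'\<in>L. \<rho>L h' \<le> ennreal C * \<rho>K h \<and> (\<forall>t>0. h t \<le> h' t)"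
    using assms(1) unfolding covered_by_def by blast
  obtain D where D: "D > 0" "\<And>h. h \<in> L \<Longrightarrow> \<exists>h'\<in>M. \<rho>M h' \<le> ennreal D * \<rho>L h \<and> (\<forall>t>0. h t \<le> h' t)"
    using assms(2) unfolding covered_by_def by blast
  show ?thesis
    unfolding covered_by_def
  proof (intro exI[of _ "D * C"] conjI ballI)
    show "0 < D * C" using C D by simp
    fix h assume "h \<in> K"
    from C(2)[OF this] obtain h1 where h1: "h1 \<in> L" "\<rho>L h1 \<le> ennreal C * \<rho>K h" "\<And>t. t > 0 \<Longrightarrow> h t \<le> h1 t"
      by blast
    from D(2)[OF h1(1)] obtain h2 where h2: "h2 \<in> M" "\<rho>M h2 \<le> ennreal D * \<rho>L h1" "\<And>t. t > 0 \<Longrightarrow> h1 t \<le> h2 t"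
      by blast
    have "\<rho>M h2 \<le> ennreal D * (ennreal C * \<rho>K h)"
      using h2(2) mult_left_mono[OF h1(2), of "ennreal D"] by (auto intro: order_trans)
    also have "\<dots> = ennreal (D * C) * \<rho>K h"
      using D by (simp add: ennreal_mult' mult.assoc)
    finally show "\<exists>h2\<in>M. \<rho>M h2 \<le> ennreal (D * C) * \<rho>K h \<and> (\<forall>t>0. h t \<le> h2 t)"
      using h1 h2 by (auto intro: order_trans)
  qed
qed

text \<open>An infinite value of the rearrangement persists at all smaller arguments, so every
  integral starting at 0 diverges.\<close>

lemma rearr2_eq_top:
  assumes "0 < t" "rearr u t = \<infinity>" "0 < s"
  shows "rearr2 u s = \<infinity>"
proof (cases "s \<le> t")
  case True
  with rearr_antimono[OF True, of u] rearr_le_rearr2[OF assms(3), of u] assms(2) show ?thesis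
    by (simp add: top_unique)
next
  case False
  have "\<infinity> = (\<integral>\<^sup>+x. \<infinity> * indicator {0<..<t} x \<partial>(lborel :: real measure))"
    using assms(1) by (subst nn_integral_cmult_indicator) (auto simp: ennreal_top_mult)
  also have "\<dots> \<le> set_nn_integral lborel {0<..<s} (rearr u)"
  proof (rule nn_integral_mono)
    fix x
    show "\<infinity> * indicator {0<..<t} x \<le> rearr u x * indicator {0<..<s} x"
      using rearr_antimono[of x t u] assms(2) False by (auto simp: indicator_def top_unique)
  qed
  finally show ?thesis
    by (simp add: rearr2_def top_unique ennreal_top_divide)
qed

theorem theorem3p5:
  fixes \<rho> :: "((real ^ 'n::finite) \<Rightarrow> ennreal) \<Rightarrow> ennreal"
    and \<Phi> :: "real \<Rightarrow> real"
  assumes "ri_norm \<rho>"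
    and "class_B CARD('n) \<Phi>"
  shows "cone_equiv (K1 \<rho> \<Phi>) (rhoK1 \<rho> \<Phi>) (K2 \<rho> \<Phi>) (rhoK2 \<rho> \<Phi>)
       \<and> cone_equiv (K2 \<rho> \<Phi>) (rhoK2 \<rho> \<Phi>) (K3 CARD('n) \<rho> \<Phi>) (rhoK3 CARD('n) \<rho> \<Phi>)
       \<and> cone_equiv (K1 \<rho> \<Phi>) (rhoK1 \<rho> \<Phi>) (K3 CARD('n) \<rho> \<Phi>) (rhoK3 CARD('n) \<rho> \<Phi>)"
proof -
  note ri = assms(1)
  note bfn = ri_norm_bfn[OF ri]
  have dim: "DIM(real^'n) = CARD('n)" by simp
  have \<Phi>: "class_B DIM(real^'n) \<Phi>" using assms(2) by simp
  have meas: "f \<in> borel_measurable lebesgue" if "f \<in> Espace \<rho>" for f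
    using that by (simp add: Espace_def)
  have M_meas: "maxfn \<Phi> f \<in> borel_measurable lebesgue" if "f \<in> Espace \<rho>" for f
    using borel_measurable_maxfn[OF meas[OF that], of \<Phi>] by (simp add: measurable_completion)
  define T1 where "T1 = (\<lambda>f::real^'n \<Rightarrow> real. rearr (maxfn \<Phi> f))"
  define T2 where "T2 = (\<lambda>f::real^'n \<Rightarrow> real. rearr2 (maxfn \<Phi> f))"
  define T3 where "T3 = (K3fun CARD('n) \<Phi> :: (real^'n \<Rightarrow> real) \<Rightarrow> real \<Rightarrow> ennreal)"
  have mono: "T1 f t \<le> T1 g t" "T2 f t \<le> T2 g t" "T3 f t \<le> T3 g t"
    if "f \<in> Espace \<rho>" "g \<in> Espace \<rho>" "AE x in lebesgue. \<bar>f x\<bar> \<le> \<bar>g x\<bar>" for f g t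
    unfolding T1_def T2_def T3_def
    by (intro rearr_mono_AE rearr2_mono_AE M_meas that AE_I2 maxfn_mono_AE K3fun_mono_AE meas)+
  have M_cmult: "maxfn \<Phi> (\<lambda>x. a * f x) = (\<lambda>x. ennreal a * maxfn \<Phi> f x)" if "f \<in> Espace \<rho>" "0 \<le> a" for f a
    using maxfn_cmult[OF meas[OF that(1)] that(2)] by (intro ext)
  have cmult: "T1 (\<lambda>x. a * f x) t = ennreal a * T1 f t" "T2 (\<lambda>x. a * f x) t = ennreal a * T2 f t"
    "T3 (\<lambda>x. a * f x) t = ennreal a * T3 f t"
    if "f \<in> Espace \<rho>" "0 \<le> a" for f a t
    unfolding T1_def T2_def T3_def using that
    by (simp_all add: M_cmult rearr_cmult rearr2_cmult M_meas K3fun_cmult meas)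
  have T3_top: "T3 f s = \<infinity>" if "f \<in> Espace \<rho>" "0 < t" "T3 f t = \<infinity>" "0 < s" for f s t
    using K3fun_eq_top[OF ri \<Phi>] that unfolding T3_def dim by blast
  obtain A where A: "0 < A" "\<And>f t. f \<in> Espace \<rho> \<Longrightarrow> 0 < t \<Longrightarrow> T2 f t \<le> ennreal A * T3 f t"
    using rearr2_maxfn_le_K3fun[OF \<Phi>] meas unfolding T2_def T3_def dim by metis
  obtain B where B: "0 < B" "\<And>f t. f \<in> Espace \<rho> \<Longrightarrow> 0 < t \<Longrightarrow> T3 f t \<le> ennreal B * T1 (radial_rearr f) t"
    using K3fun_le_rearr_maxfn[OF ri \<Phi>] unfolding T1_def T3_def dim by metis

  have "covered_by (cone \<rho> T1) (cone_gauge \<rho> T1) (cone \<rho> T2) (cone_gauge \<rho> T2)"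
  proof (rule covered_by_cone[OF bfn mono(1) cmult(1) cmult(2), where C = 1])
    fix f assume f: "f \<in> Espace \<rho>"
    then show "\<exists>g\<in>Espace \<rho>. Enorm \<rho> g \<le> ennreal 1 * Enorm \<rho> f \<and> (\<forall>t>0. T1 f t \<le> T2 g t) \<and>
        ((\<exists>t>0. T1 f t = \<infinity>) \<longrightarrow> (\<forall>t>0. T2 g t = \<infinity>))"
      unfolding T1_def T2_def using rearr2_eq_top[of _ "maxfn \<Phi> f"]
      by (intro bexI[of _ f]) (auto intro: rearr_le_rearr2)
  qed auto
  moreover have "covered_by (cone \<rho> T2) (cone_gauge \<rho> T2) (cone \<rho> T3) (cone_gauge \<rho> T3)"
  proof (rule covered_by_cone[OF bfn mono(2) cmult(2) cmult(3) A(1)])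
    fix f assume f: "f \<in> Espace \<rho>"
    \<comment> \<open>Covering compares functions without a constant, so the constant of the
      estimate moves into the witness.\<close>
    let ?g = "\<lambda>x. A * f x"
    have g: "?g \<in> Espace \<rho>" "Enorm \<rho> ?g = ennreal A * Enorm \<rho> f"
      using A(1) f by (auto intro: Espace_cmult[OF bfn] Enorm_cmult[OF bfn])
    have le: "T2 f t \<le> T3 ?g t" if "0 < t" for t
      using A f that by (simp add: cmult)
    \<comment> \<open>The infinite value passes to \<open>T3 ?g\<close> at the same t and only then
      spreads to s.\<close>
    have "T3 ?g s = \<infinity>" if "0 < t" "T2 f t = \<infinity>" "0 < s" for t s
      using le[OF that(1)] that by (intro T3_top[OF g(1) that(1) _ that(3)]) (simp add: top_unique)
    with g le show "\<exists>g\<in>Espace \<rho>. Enorm \<rho> g \<le> ennreal A * Enorm \<rho> f \<and> (\<forall>t>0. T2 f t \<le> T3 g t) \<and>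
        ((\<exists>t>0. T2 f t = \<infinity>) \<longrightarrow> (\<forall>t>0. T3 g t = \<infinity>))"
      by (intro bexI[of _ ?g]) auto
  qed auto
  moreover have "covered_by (cone \<rho> T3) (cone_gauge \<rho> T3) (cone \<rho> T1) (cone_gauge \<rho> T1)"
  proof (rule covered_by_cone[OF bfn mono(3) cmult(3) cmult(1) B(1)])
    fix f assume f: "f \<in> Espace \<rho>"
    let ?g = "\<lambda>x. B * radial_rearr f x"
    note r = radial_rearr_Espace[OF ri f]
    have g: "?g \<in> Espace \<rho>" "Enorm \<rho> ?g \<le> ennreal B * Enorm \<rho> f"
      using B(1) Enorm_cmult[OF bfn r, of B] Enorm_radial_rearr_le[OF ri f]
      by (auto intro: Espace_cmult[OF bfn r] mult_left_mono)
    have le: "T3 f t \<le> T1 ?g t" if "0 < t" for t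
      using B f r that by (simp add: cmult)
    \<comment> \<open>Here the infinite value first spreads within \<open>T3 f\<close>, and the
      comparison is made at s.\<close>
    have "T1 ?g s = \<infinity>" if "0 < t" "T3 f t = \<infinity>" "0 < s" for t s
      using le[OF that(3)] T3_top[OF f that] by (simp add: top_unique)
    with g le show "\<exists>g\<in>Espace \<rho>. Enorm \<rho> g \<le> ennreal B * Enorm \<rho> f \<and> (\<forall>t>0. T3 f t \<le> T1 g t) \<and>
        ((\<exists>t>0. T3 f t = \<infinity>) \<longrightarrow> (\<forall>t>0. T1 g t = \<infinity>))"
      by (intro bexI[of _ ?g]) auto
  qed auto
  \<comment> \<open>Transitivity along the cycle supplies the three remaining coverings.\<close>
  ultimately show ?thesis
    unfolding cone_equiv_def K1_eq_cone[OF bfn] K2_eq_cone[OF bfn] rhoK1_eq_gauge[OF bfn]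
      rhoK2_eq_gauge[OF bfn] K3_eq_cone rhoK3_eq_gauge T1_def[symmetric] T2_def[symmetric] T3_def[symmetric]
    by (blast intro: covered_by_trans)
qed

end
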